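(* Let $N\ge1$ be an integer and suppose $a>\max\{0,2-N\}$. Let $(\{P_x\}_{x\in\mathbb{R}^N},(B_t)_{t\ge0})$ be the standard $a$-deformed Brownian motion on $(W,\mathfrak{B}(W))$, let $s,t\ge0$, and let $f:W\to\mathbb{R}$ be a bounded $\mathfrak{B}(W)_s$-measurable function. Then for every $x\in\mathbb{R}^N$, $$E_x\left(f(\theta_t\omega)\,\middle|\,\mathfrak{B}(W)_t\right)=E_{B_t}(f)\qquad P_x\text{-almost surely}.$$
   Context: Normalized I-Bessel function: for $\mu\in\mathbb{R}$ and $w\in\mathbb{C}$, $\tilde I_\mu(w)=\sum_{j=0}^\infty\frac{(w/2)^{2j}}{j!\,\Gamma(\mu+j+1)}$ (with $1/\Gamma=0$ at the poles of $\Gamma$). Normalized Gegenbauer polynomials $\check C^\nu_m(t)$ are defined by the formal power series expansion $\frac{1-x^2}{(1-2tx+x^2)^{\nu+1}}=\sum_{m=0}^\infty\check C^\nu_m(t)x^m$. For $b>0$, $\nu\in\mathbb{R}$ with $1+b\nu>0$, $w\in\mathbb{C}$, $t\in[-1,1]$, $$\mathscr{I}(b,\nu,w,t):=\Gamma(b\nu+1)\sum_{m=0}^\infty\left(\frac w2\right)^{bm}\tilde I_{b(m+\nu)}(w)\,\check C^\nu_m(t),$$ where $(w/2)^s=(|w|/2)^se^{i\theta s}$ for $w=|w|e^{i\theta}$, $\theta\in(-\pi,\pi]$; the series converges absolutely and locally uniformly. For $a>\max\{0,2-N\}$ put $B_a(r\omega,s\mu)=\mathscr{I}\left(\frac2a,\frac{N-2}{2},\frac{2(rs)^{a/2}}{ai},\langle\omega,\mu\rangle\right)$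 for $r,s\ge0$, $\omega,\mu\in S^{N-1}$, and $c_a=\left(\int_{\mathbb{R}^N}e^{-\frac1a|x|^a}\frac{dx}{|x|^{2-a}}\right)^{-1}$. The $a$-deformed heat kernel is $$h_a(x,y;t)=c_a\int_{\mathbb{R}^N}\overline{B_a(x,\xi)}\,B_a(y,\xi)\,e^{-\frac ta|\xi|^a}\frac{d\xi}{|\xi|^{2-a}}\qquad(x,y\in\mathbb{R}^N,\ t>0),$$ an absolutely convergent integral. Let $W=C([0,\infty),\mathbb{R}^N)$ with Borel $\sigma$-algebra $\mathfrak{B}(W)$ for the compact-open topology, and $B_t(\omega)=\omega_t$. The standard $a$-deformed Brownian motion is $(\{P_x\}_{x\in\mathbb{R}^N},(B_t)_{t\ge0})$, where $\{P_x\}$ (the $a$-deformed Wiener measures) is the unique family of probability measures on $(W,\mathfrak{B}(W))$ such that for every $x$: $P_x(B_0=x)=1$, and for all $0=t_0<t_1<\dots<t_n$ and Borel sets $A_1,\dots,A_n\subset\mathbb{R}^N$, with $x_0=x$, $$P_x(B_{t_i}\in A_i,\ i=1,\dots,n)=\int_{A_1}\frac{c_a\,dx_1}{|x_1|^{2-a}}\cdots\int_{A_n}\frac{c_a\,dx_n}{|x_n|^{2-a}}\prod_{i=1}^nh_a(x_{i-1},x_i;t_i-t_{i-1}).$$ $\mathfrak{B}(W)_t:=\sigma(B_s;\,s\le t)$. $E_x$ denotes expectation with respect to $P_x$, $E_x(\cdot\,|\,\mathscr{G})$ conditional expectation with respect to a sub-$\sigma$-algebra $\mathscr{G}$, and $E_{B_t}(f)$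 is the random variable $\omega\mapsto E_y(f)|_{y=B_t(\omega)}$. The time shift $\theta_t:W\to W$ is defined by $B_s(\theta_t\omega)=B_{s+t}(\omega)$. *)

theory Defs
  imports "HOL-Probability.Probability" "HOL-Computational_Algebra.Formal_Power_Series"
begin

section \<open>Special functions\<close>

text \<open>\<^const>\<open>rGamma\<close> is the entire function 1/Gamma, which vanishes at the poles of Gamma.\<close>

definition normalized_Bessel_I :: "real \<Rightarrow> complex \<Rightarrow> complex" where
  "normalized_Bessel_I \<mu> w =
     (\<Sum>j. (w / 2) ^ (2 * j) / fact j * of_real (rGamma (\<mu> + real j + 1)))"

text \<open>The formal power series (1 + u)^(nu+1) is \<^term>\<open>fps_binomial (\<nu> + 1)\<close>; here it is
  composed with u = -2tX + X^2.\<close>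

definition normalized_Gegenbauer :: "real \<Rightarrow> nat \<Rightarrow> real \<Rightarrow> real" where
  "normalized_Gegenbauer \<nu> m t =
     fps_nth ((1 - fps_X ^ 2) /
       fps_compose (fps_binomial (\<nu> + 1)) (fps_X ^ 2 - fps_const (2 * t) * fps_X)) m"

text \<open>The principal power |w|^s exp(i s Arg w), with Arg in (-pi, pi], which for s = 0 is 1 also
  at w = 0 (whereas \<^term>\<open>0 powr 0 = (0::complex)\<close> in the library).\<close>

definition principal_power :: "complex \<Rightarrow> real \<Rightarrow> complex" where
  "principal_power w s = (if s = 0 then 1 else w powr of_real s)"

definition scrI :: "real \<Rightarrow> real \<Rightarrow> complex \<Rightarrow> real \<Rightarrow> complex" where
  "scrI b \<nu> w t = of_real (Gamma (b * \<nu> + 1)) *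
     (\<Sum>m. principal_power (w / 2) (b * real m) * normalized_Bessel_I (b * (real m + \<nu>)) w *
           of_real (normalized_Gegenbauer \<nu> m t))"


section \<open>The deformed heat kernel\<close>

text \<open>With x = r omega and y = s mu the last argument of \<^const>\<open>scrI\<close> is the inner product of
  omega and mu. If x = 0 or y = 0, the unit vectors are not determined, but then the third argument
  is 0 and only the summand m = 0 remains; it does not depend on the last argument
  (\<^term>\<open>sgn 0\<close> makes that argument 0).\<close>

definition kernel_B :: "real \<Rightarrow> real ^ 'n::finite \<Rightarrow> real ^ 'n \<Rightarrow> complex" where
  "kernel_B a x y =
     scrI (2 / a) ((real CARD('n) - 2) / 2)
       (of_real (2 * (norm x * norm y) powr (a / 2)) / (of_real a * \<i>))
       (inner (sgn x) (sgn y))"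

definition deformed_const :: "'n::finite itself \<Rightarrow> real \<Rightarrow> real" where
  "deformed_const _ a =
     inverse (\<integral>x. exp (- (1 / a) * norm x powr a) / norm x powr (2 - a) \<partial>(lborel :: (real ^ 'n) measure))"

definition heat_kernel :: "real \<Rightarrow> real ^ 'n::finite \<Rightarrow> real ^ 'n \<Rightarrow> real \<Rightarrow> complex" where
  "heat_kernel a x y t = of_real (deformed_const TYPE('n) a) *
     (\<integral>\<xi>. cnj (kernel_B a x \<xi>) * kernel_B a y \<xi> *
          of_real (exp (- (t / a) * norm \<xi> powr a) / norm \<xi> powr (2 - a)) \<partial>lborel)"

definition deformed_measure :: "real \<Rightarrow> (real ^ 'n::finite) measure" where
  "deformed_measure a =
     density lborel (\<lambda>x. ennreal (deformed_const TYPE('n) a / norm x powr (2 - a)))"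


section \<open>Path space\<close>

text \<open>Continuous maps on [0, oo) are represented by functions on the reals that are
  \<^const>\<open>undefined\<close> at negative arguments, so that equality is equality on [0, oo).\<close>

definition path_space :: "(real \<Rightarrow> real ^ 'n::finite) set" where
  "path_space = {\<omega> \<in> extensional {0..}. continuous_on {0..} \<omega>}"

definition compact_open_topology :: "(real \<Rightarrow> real ^ 'n::finite) topology" where
  "compact_open_topology =
     topology_generated_by
       {{\<omega> \<in> path_space. \<omega> ` K \<subseteq> U} | K U. compact K \<and> K \<subseteq> {0..} \<and> open U}"

definition path_borel :: "(real \<Rightarrow> real ^ 'n::finite) measure" where
  "path_borel = sigma path_space {U. openin compact_open_topology U}"

definition path_filtration :: "real \<Rightarrow> (real \<Rightarrow> real ^ 'n::finite) measure" where
  "path_filtration t =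
     sigma path_space {{\<omega> \<in> path_space. \<omega> u \<in> A} | u A. 0 \<le> u \<and> u \<le> t \<and> A \<in> sets borel}"

definition time_shift :: "real \<Rightarrow> (real \<Rightarrow> real ^ 'n::finite) \<Rightarrow> (real \<Rightarrow> real ^ 'n)" where
  "time_shift t \<omega> = restrict (\<lambda>s. \<omega> (s + t)) {0..}"


section \<open>Deformed Wiener measures\<close>

text \<open>The iterated integral of g [x1, ..., xn] over x1 in A1 (outermost), ..., xn in An
  (innermost), where the list of sets is [A1, ..., An].\<close>

primrec iterated_integral :: "'a measure \<Rightarrow> 'a set list \<Rightarrow> ('a list \<Rightarrow> complex) \<Rightarrow> complex" where
  "iterated_integral M [] g = g []"
| "iterated_integral M (A # As) g = (LINT x:A|M. iterated_integral M As (\<lambda>xs. g (x # xs)))"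

text \<open>The heat kernel is complex-valued by definition, so the formula for the finite-dimensional
  distributions is an equation between complex numbers. The list \<^term>\<open>x # xs\<close> holds the points
  x0 = x, x1, ..., xn.\<close>

definition deformed_Wiener_family ::
    "real \<Rightarrow> (real ^ 'n::finite \<Rightarrow> (real \<Rightarrow> real ^ 'n) measure) \<Rightarrow> bool" where
  "deformed_Wiener_family a P \<longleftrightarrow>
     (\<forall>x. prob_space (P x) \<and> space (P x) = path_space \<and> sets (P x) = sets path_borel \<and>
        measure (P x) {\<omega> \<in> path_space. \<omega> 0 = x} = 1 \<and>
        (\<forall>n \<ge> 1. \<forall>\<tau> A. \<tau> 0 = 0 \<and> (\<forall>i<n. \<tau> i < \<tau> (Suc i)) \<and> (\<forall>i\<in>{1..n}. A i \<in> sets borel) \<longrightarrow>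
           complex_of_real (measure (P x) {\<omega> \<in> path_space. \<forall>i\<in>{1..n}. \<omega> (\<tau> i) \<in> A i}) =
           iterated_integral (deformed_measure a) (map A [1..<Suc n])
             (\<lambda>xs. \<Prod>i=1..n. heat_kernel a ((x # xs) ! (i - 1)) ((x # xs) ! i) (\<tau> i - \<tau> (i - 1)))))"

end

theory Submission
  imports Defs "HOL-Complex_Analysis.Cauchy_Integral_Theorem"
begin

text \<open>Nothing about the heat kernel h is needed beyond its measurability. The formula for the
  finite-dimensional distributions shows that h(x, -, d) has integral 1, hence is integrable (the
  integral would otherwise be 0), and that its integrals over Borel sets are probabilities, hence
  that it is almost everywhere a nonnegative density of the law of B_d under P_x. Separating the
  first factor of the kernel product in the same formula gives, for cylinder sets E,
  P_x(B_d in A, theta_d in E) = E_x[1_A(B_d) P_{B_d}(E)]; it also shows inductively that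
  P_y(E) is measurable in y. By uniqueness of measures this extends from indicators of cylinders
  to all nonnegative measurable functionals of the shifted path. Splitting off the times of a
  cylinder set one by one, and then using uniqueness of measures once more, replaces the event
  {B_d in A} by any event of the past up to t.\<close>

section \<open>Measurability of the heat kernel\<close>

lemma borel_measurable_fps_mult_nth:
  fixes F G :: "'a \<Rightarrow> real fps"
  assumes "\<And>n. (\<lambda>x. fps_nth (F x) n) \<in> borel_measurable M"
    and "\<And>n. (\<lambda>x. fps_nth (G x) n) \<in> borel_measurable M"
  shows "(\<lambda>x. fps_nth (F x * G x) n) \<in> borel_measurable M"
  unfolding fps_mult_nth by (intro borel_measurable_sum borel_measurable_times assms)

lemma borel_measurable_fps_power_nth:
  fixes F :: "'a \<Rightarrow> real fps"
  assumes "\<And>n. (\<lambda>x. fps_nth (F x) n) \<in> borel_measurable M"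
  shows "(\<lambda>x. fps_nth (F x ^ k) n) \<in> borel_measurable M"
proof (induction k arbitrary: n)
  case (Suc k)
  show ?case
    unfolding power_Suc by (intro borel_measurable_fps_mult_nth assms Suc)
qed simp

text \<open>Each coefficient of the inverse is obtained from lower ones by sums and products, so
  strong induction applies. The recursion also covers points where the constant term is 0, since
  both sides are 0 there.\<close>

lemma borel_measurable_fps_inverse_nth:
  fixes F :: "'a \<Rightarrow> real fps"
  assumes "\<And>n. (\<lambda>x. fps_nth (F x) n) \<in> borel_measurable M"
  shows "(\<lambda>x. fps_nth (inverse (F x)) n) \<in> borel_measurable M"
proof (induction n rule: less_induct)
  case (less n)
  show ?case
  proof (cases n)
    case 0
    then show ?thesis
      using borel_measurable_inverse[OF assms] by (simp add: fps_inverse_def)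
  next
    case (Suc k)
    have *: "fps_nth (inverse (F x)) n = - inverse (fps_nth (F x) 0) *
        (\<Sum>i = 1..n. fps_nth (F x) i * fps_nth (inverse (F x)) (n - i))" for x
      unfolding Suc fps_inverse_def fps_nth_Abs_fps by simp
    show ?thesis
      unfolding *
      by (intro borel_measurable_times borel_measurable_uminus borel_measurable_inverse
          borel_measurable_sum assms less) (use Suc in auto)
  qed
qed

lemma borel_measurable_normalized_Gegenbauer:
  "normalized_Gegenbauer \<nu> m \<in> borel_measurable borel"
proof -
  define g where "g t = fps_compose (fps_binomial (\<nu> + 1)) (fps_X ^ 2 - fps_const (2 * t) * fps_X)"
    for t :: real
  have 1: "(\<lambda>t. fps_nth (fps_X ^ 2 - fps_const (2 * t) * fps_X :: real fps) n) \<in> borel_measurable borel" for n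
    unfolding fps_sub_nth fps_mult_left_const_nth
    by (intro borel_measurable_diff borel_measurable_times borel_measurable_const
        measurable_ident_sets refl)
  have 2: "(\<lambda>t. fps_nth (g t) n) \<in> borel_measurable borel" for n
    unfolding g_def fps_compose_nth
    by (rule borel_measurable_sum, rule borel_measurable_times[OF borel_measurable_const],
        rule borel_measurable_fps_power_nth, rule 1)
  \<comment> \<open>The constant term is the binomial coefficient 1, so \<open>g t\<close> is a unit
    and division of power series is multiplication by its inverse.\<close>
  have "fps_nth (g t) 0 \<noteq> 0" for t
    unfolding g_def
    by (simp only: fps_compose_nth_0 fps_binomial_nth gbinomial_0 one_neq_zero not_False_eq_True)
  then have "normalized_Gegenbauer \<nu> m = (\<lambda>t. fps_nth ((1 - fps_X ^ 2) * inverse (g t)) m)"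
    unfolding normalized_Gegenbauer_def[abs_def] g_def by (simp only: fps_divide_unit not_False_eq_True)
  moreover have "(\<lambda>t. fps_nth ((1 - fps_X ^ 2) * inverse (g t)) m) \<in> borel_measurable borel"
    by (rule borel_measurable_fps_mult_nth[OF borel_measurable_const
        borel_measurable_fps_inverse_nth[OF 2]])
  ultimately show ?thesis by simp
qed

lemma borel_measurable_normalized_Bessel_I:
  "normalized_Bessel_I \<mu> \<in> borel_measurable borel"
  unfolding normalized_Bessel_I_def[abs_def]
  by (intro borel_measurable_suminf borel_measurable_times borel_measurable_divide
      borel_measurable_power borel_measurable_const measurable_ident_sets refl)

lemma borel_measurable_principal_power:
  "(\<lambda>w. principal_power w s) \<in> borel_measurable borel"
proof (cases "s = 0")
  case False
  \<comment> \<open>This is \<open>powr\<close> written out. The principal branch \<open>Ln\<close>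
    jumps across the negative real axis but is still Borel.\<close>
  have "(\<lambda>w :: complex. if w = 0 then 0 else exp (of_real s * Ln w)) \<in> borel_measurable borel"
    by (intro measurable_If borel_measurable_const measurable_compose[OF _ borel_measurable_exp]
        borel_measurable_times Ln_measurable) auto
  with False show ?thesis by (simp add: principal_power_def powr_def)
qed (simp add: principal_power_def)

lemma borel_measurable_scrI:
  assumes "f \<in> borel_measurable M" "g \<in> borel_measurable M"
  shows "(\<lambda>z. scrI b \<nu> (f z) (g z)) \<in> borel_measurable M"
proof -
  have *: "(\<lambda>z. principal_power (f z / 2) (b * real m) * normalized_Bessel_I (b * (real m + \<nu>)) (f z) *
      complex_of_real (normalized_Gegenbauer \<nu> m (g z))) \<in> borel_measurable M" for m
    using assms
    by (intro borel_measurable_times borel_measurable_divide borel_measurable_const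
        measurable_compose[OF _ borel_measurable_principal_power]
        measurable_compose[OF _ borel_measurable_normalized_Bessel_I]
        measurable_compose[OF _ borel_measurable_of_real]
        measurable_compose[OF _ borel_measurable_normalized_Gegenbauer])
  show ?thesis
    unfolding scrI_def
    by (rule borel_measurable_times[OF borel_measurable_const borel_measurable_suminf[OF *]])
qed

lemma borel_measurable_kernel_B:
  fixes f g :: "'a \<Rightarrow> real ^ 'n::finite"
  assumes [measurable]: "f \<in> borel_measurable M" "g \<in> borel_measurable M"
  shows "(\<lambda>z. kernel_B a (f z) (g z)) \<in> borel_measurable M"
  unfolding kernel_B_def sgn_div_norm by (rule borel_measurable_scrI) measurable

text \<open>A parameter integral over the sigma-finite Lebesgue measure is measurable in the
  parameter; the default value 0 of a divergent Bochner integral makes this valid at every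
  argument.\<close>

lemma borel_measurable_heat_kernel:
  fixes f g :: "'a \<Rightarrow> real ^ 'n::finite"
  assumes [measurable]: "f \<in> borel_measurable M" "g \<in> borel_measurable M"
  shows "(\<lambda>z. heat_kernel a (f z) (g z) t) \<in> borel_measurable M"
proof -
  have [measurable]: "cnj \<in> borel_measurable borel"
    by (intro borel_measurable_continuous_onI continuous_intros)
  note borel_measurable_kernel_B[measurable]
  show ?thesis
    unfolding heat_kernel_def
    by (intro borel_measurable_times borel_measurable_const
        sigma_finite_measure.borel_measurable_lebesgue_integral[OF lborel.sigma_finite_measure_axioms])
       measurable
qed

text \<open>The density is a real number at every point, the origin included, where division by 0
  yields 0 whenever the power vanishes; finite densities preserve sigma-finiteness.\<close>

lemma sigma_finite_deformed_measure:
  "sigma_finite_measure (deformed_measure a :: (real ^ 'n::finite) measure)"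
  unfolding deformed_measure_def
  by (subst sigma_finite_measure.sigma_finite_iff_density_finite[OF sigma_finite_lborel]) auto

lemma sets_deformed_measure [measurable_cong, simp]: "sets (deformed_measure a) = sets borel"
  by (simp add: deformed_measure_def)

lemma space_deformed_measure [simp]: "space (deformed_measure a) = UNIV"
  by (simp add: deformed_measure_def)


section \<open>Cylinder sets in path space\<close>

definition cylinder :: "real set \<Rightarrow> (real \<Rightarrow> (real ^ 'n::finite) set) \<Rightarrow> (real \<Rightarrow> real ^ 'n) set" where
  "cylinder J A = {\<omega> \<in> path_space. \<forall>u\<in>J. \<omega> u \<in> A u}"

definition cylinders :: "real set \<Rightarrow> (real \<Rightarrow> real ^ 'n::finite) set set" where
  "cylinders I = {cylinder J A | J A. finite J \<and> J \<subseteq> I \<and> (\<forall>u. A u \<in> sets borel)}"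

text \<open>This is the sigma-algebra of the coordinates with times in I. With I =
  \<open>{0..t}\<close> it is the past up to t; with I = \<open>{0..}\<close> it carries all path
  laws below, which are determined by their values on the pi-system
  \<open>cylinders I\<close>.\<close>

definition path_sigma :: "real set \<Rightarrow> (real \<Rightarrow> real ^ 'n::finite) measure" where
  "path_sigma I = sigma path_space (cylinders I)"

lemma cylinders_subset: "cylinders I \<subseteq> Pow path_space"
  by (auto simp: cylinders_def cylinder_def)

lemma cylinderI: "finite J \<Longrightarrow> J \<subseteq> I \<Longrightarrow> (\<And>u. A u \<in> sets borel) \<Longrightarrow> cylinder J A \<in> cylinders I"
  by (auto simp: cylinders_def)

lemma space_path_sigma [simp]: "space (path_sigma I) = path_space"
  by (simp add: path_sigma_def cylinders_subset space_measure_of)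

lemma sets_path_sigma: "sets (path_sigma I) = sigma_sets path_space (cylinders I)"
  by (simp add: path_sigma_def cylinders_subset)

lemma path_space_in_path_sigma [simp]: "path_space \<in> sets (path_sigma I)"
  by (metis sets.top space_path_sigma)

lemma Int_stable_cylinders: "Int_stable (cylinders I)"
proof (rule Int_stableI)
  fix X Y :: "(real \<Rightarrow> real ^ 'n) set"
  assume "X \<in> cylinders I" "Y \<in> cylinders I"
  then obtain J A J' A' where *: "X = cylinder J A" "Y = cylinder J' A'"
    "finite J" "finite J'" "J \<subseteq> I" "J' \<subseteq> I" "\<And>u. A u \<in> sets borel" "\<And>u. A' u \<in> sets borel"
    unfolding cylinders_def by blast
  \<comment> \<open>The intersection constrains the union of both time sets; \<open>UNIV\<close>
    stands in where one of the two cylinders imposes nothing.\<close>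
  let ?B = "\<lambda>u. (if u \<in> J then A u else UNIV) \<inter> (if u \<in> J' then A' u else UNIV)"
  have "X \<inter> Y = cylinder (J \<union> J') ?B"
    unfolding * cylinder_def by auto
  then show "X \<inter> Y \<in> cylinders I"
    using * by (auto intro!: cylinderI)
qed

lemma path_space_in_cylinders: "path_space \<in> cylinders I"
  using cylinderI[of "{}" I "\<lambda>_. UNIV"] by (simp add: cylinder_def)

lemma cylinder_in_path_sigma:
  "finite J \<Longrightarrow> J \<subseteq> I \<Longrightarrow> (\<And>u. A u \<in> sets borel) \<Longrightarrow> cylinder J A \<in> sets (path_sigma I)"
  by (auto simp: sets_path_sigma intro: cylinderI)

lemma measurable_path_eval: "u \<in> I \<Longrightarrow> (\<lambda>\<omega>. \<omega> u) \<in> path_sigma I \<rightarrow>\<^sub>M borel"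
proof (rule measurableI)
  fix A :: "(real ^ 'n) set"
  assume "u \<in> I" "A \<in> sets borel"
  then have "cylinder {u} (\<lambda>_. A) \<in> sets (path_sigma I)"
    by (intro cylinder_in_path_sigma) auto
  also have "cylinder {u} (\<lambda>_. A) = (\<lambda>\<omega>. \<omega> u) -` A \<inter> space (path_sigma I)"
    by (auto simp: cylinder_def)
  finally show "(\<lambda>\<omega>. \<omega> u) -` A \<inter> space (path_sigma I) \<in> sets (path_sigma I)" .
qed simp

text \<open>The preimage of a cylinder is a finite intersection of coordinate events, so
  measurability can be tested coordinate by coordinate.\<close>

lemma measurable_into_path_sigma:
  assumes "\<And>z. z \<in> space N \<Longrightarrow> f z \<in> path_space"
    and f: "\<And>u. u \<in> I \<Longrightarrow> (\<lambda>z. f z u) \<in> N \<rightarrow>\<^sub>M borel"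
  shows "f \<in> N \<rightarrow>\<^sub>M path_sigma I"
  unfolding path_sigma_def
proof (rule measurable_measure_of[OF cylinders_subset])
  fix X :: "(real \<Rightarrow> real ^ 'b) set"
  assume "X \<in> cylinders I"
  then obtain J A where *: "X = cylinder J A" "finite J" "J \<subseteq> I" "\<And>u. A u \<in> sets borel"
    unfolding cylinders_def by blast
  have "{z \<in> space N. \<forall>u\<in>J. f z u \<in> A u} \<in> sets N"
    using * by (intro sets.sets_Collect_finite_All measurable_sets_Collect[OF f]) auto
  also have "{z \<in> space N. \<forall>u\<in>J. f z u \<in> A u} = f -` X \<inter> space N"
    using assms(1) by (auto simp: * cylinder_def)
  finally show "f -` X \<inter> space N \<in> sets N" .
qed (use assms in auto)

text \<open>A one-time event is a cylinder with a single time. Conversely, all coordinates up to t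
  are measurable for the filtration, hence so is the identity map into
  \<open>path_sigma {0..t}\<close>.\<close>

lemma sets_path_filtration: "sets (path_filtration t) = sets (path_sigma {0..t} :: (real \<Rightarrow> real ^ 'n::finite) measure)"
proof -
  define G where "G = {{\<omega> \<in> path_space. \<omega> u \<in> A} | u (A :: (real ^ 'n) set). 0 \<le> u \<and> u \<le> t \<and> A \<in> sets borel}"
  have G: "G \<subseteq> Pow path_space"
    by (auto simp: G_def)
  have F: "path_filtration t = sigma path_space G"
    by (simp add: path_filtration_def G_def)
  show ?thesis
  proof
    show "sets (path_filtration t) \<subseteq> sets (path_sigma {0..t} :: (real \<Rightarrow> real ^ 'n) measure)"
      unfolding F sets_measure_of[OF G]
    proof (rule sets.sigma_sets_subset'[of _ "path_sigma {0..t} :: (real \<Rightarrow> real ^ 'n) measure", simplified])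
      show "G \<subseteq> sets (path_sigma {0..t})"
      proof
        fix X assume "X \<in> G"
        then obtain u A where X: "X = {\<omega> \<in> path_space. \<omega> u \<in> A}" "u \<in> {0..t}" "A \<in> sets borel"
          unfolding G_def by auto
        then have "cylinder {u} (\<lambda>_. A) \<in> sets (path_sigma {0..t})"
          by (intro cylinder_in_path_sigma) auto
        then show "X \<in> sets (path_sigma {0..t})"
          by (simp add: X cylinder_def)
      qed
      show "path_space \<in> sets (path_sigma {0..t} :: (real \<Rightarrow> real ^ 'n) measure)"
        by simp
    qed
    have "(\<lambda>\<omega>. \<omega>) \<in> path_filtration t \<rightarrow>\<^sub>M (path_sigma {0..t} :: (real \<Rightarrow> real ^ 'n) measure)"
    proof (rule measurable_into_path_sigma)
      fix u assume u: "u \<in> {0..t}"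
      show "(\<lambda>\<omega> :: real \<Rightarrow> real ^ 'n. \<omega> u) \<in> path_filtration t \<rightarrow>\<^sub>M borel"
      proof (rule measurableI)
        fix A :: "(real ^ 'n) set" assume "A \<in> sets borel"
        then have "{\<omega> \<in> path_space. \<omega> u \<in> A} \<in> G"
          unfolding G_def using u by auto
        then show "(\<lambda>\<omega>. \<omega> u) -` A \<inter> space (path_filtration t) \<in> sets (path_filtration t)"
          unfolding F space_measure_of[OF G] sets_measure_of[OF G]
          by (auto simp: vimage_def Int_def conj_commute)
      qed simp
    qed (simp add: F space_measure_of[OF G])
    from measurable_sets[OF this]
    show "sets (path_sigma {0..t} :: (real \<Rightarrow> real ^ 'n) measure) \<subseteq> sets (path_filtration t)"
      using sets.sets_into_space by (fastforce simp: F space_measure_of[OF G] Int_absorb2)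
  qed
qed

lemma measurable_path_sigma_mono:
  assumes "I \<subseteq> I'"
  shows "(\<lambda>\<omega>. \<omega>) \<in> path_sigma I' \<rightarrow>\<^sub>M path_sigma I"
  using assms by (intro measurable_into_path_sigma) (auto intro!: measurable_path_eval)

section \<open>Coordinates and the compact-open topology\<close>

lemma openin_compact_open_subset:
  "openin compact_open_topology U \<Longrightarrow> U \<subseteq> path_space"
  by (drule openin_subset) (auto simp: compact_open_topology_def)

lemma space_path_borel [simp]: "space path_borel = path_space"
  unfolding path_borel_def using openin_compact_open_subset by (intro space_measure_of) auto

lemma sets_path_borel: "sets path_borel = sigma_sets path_space {U. openin compact_open_topology U}"
  unfolding path_borel_def using openin_compact_open_subset by (intro sets_measure_of) auto

text \<open>Taking the compact set to be \<open>{u}\<close> shows that evaluation at u pulls open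
  sets back to subbasic open sets.\<close>

lemma measurable_path_borel_path_sigma:
  assumes "I \<subseteq> {0..}"
  shows "(\<lambda>\<omega>. \<omega>) \<in> path_borel \<rightarrow>\<^sub>M path_sigma I"
proof (rule measurable_into_path_sigma)
  fix u assume "u \<in> I"
  with assms have u: "u \<ge> 0" by auto
  show "(\<lambda>\<omega> :: real \<Rightarrow> real ^ 'a. \<omega> u) \<in> borel_measurable path_borel"
  proof (rule borel_measurableI)
    fix S :: "(real ^ 'a) set" assume "open S"
    with u have "openin compact_open_topology {\<omega> \<in> path_space. \<omega> ` {u} \<subseteq> S}"
      unfolding compact_open_topology_def openin_topology_generated_by_iff
      by (intro generate_topology_on.Basis) (auto intro!: exI[of _ "{u}"])
    then show "(\<lambda>\<omega>. \<omega> u) -` S \<inter> space path_borel \<in> sets path_borel"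
      by (auto simp: sets_path_borel vimage_def Int_def conj_commute)
  qed
qed simp

section \<open>The time shift on path space\<close>

lemma time_shift_apply [simp]: "u \<ge> 0 \<Longrightarrow> time_shift t \<omega> u = \<omega> (u + t)"
  by (simp add: time_shift_def)

lemma time_shift_in_path_space:
  assumes "t \<ge> 0" "\<omega> \<in> path_space"
  shows "time_shift t \<omega> \<in> path_space"
proof -
  have "continuous_on {0..} (\<lambda>u. \<omega> (u + t))"
    by (rule continuous_on_compose2[of "{0..}" \<omega>])
       (use assms in \<open>auto simp: path_space_def intro!: continuous_intros\<close>)
  then have "continuous_on {0..} (time_shift t \<omega>)"
    by (rule continuous_on_eq) simp
  then show ?thesis
    by (simp add: path_space_def time_shift_def)
qed

lemma time_shift_in_cylinder_iff:
  assumes "t \<ge> 0" "J \<subseteq> {0..}" "\<omega> \<in> path_space"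
  shows "time_shift t \<omega> \<in> cylinder J C \<longleftrightarrow> (\<forall>u\<in>J. \<omega> (u + t) \<in> C u)"
proof -
  have "time_shift t \<omega> u = \<omega> (u + t)" if "u \<in> J" for u
    using assms that by (intro time_shift_apply) auto
  then show ?thesis
    using assms by (simp add: cylinder_def time_shift_in_path_space)
qed

lemma time_shift_0: "\<omega> \<in> path_space \<Longrightarrow> time_shift 0 \<omega> = \<omega>"
  by (auto simp: path_space_def time_shift_def extensional_restrict)

lemma time_shift_time_shift:
  "s \<ge> 0 \<Longrightarrow> time_shift s (time_shift t \<omega>) = time_shift (s + t) \<omega>"
  by (auto simp: time_shift_def fun_eq_iff restrict_def add.assoc)

lemma measurable_time_shift:
  assumes "t \<ge> 0" "I \<subseteq> {0..}" "(\<lambda>u. u + t) ` I \<subseteq> I'"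
  shows "time_shift t \<in> path_sigma I' \<rightarrow>\<^sub>M path_sigma I"
proof (rule measurable_into_path_sigma)
  fix u assume u: "u \<in> I"
  then have "(\<lambda>\<omega>. \<omega> (u + t)) \<in> path_sigma I' \<rightarrow>\<^sub>M borel"
    using assms by (intro measurable_path_eval) auto
  then show "(\<lambda>\<omega>. time_shift t \<omega> u) \<in> path_sigma I' \<rightarrow>\<^sub>M borel"
    using assms u by (subst time_shift_apply) auto
qed (use assms in \<open>auto intro: time_shift_in_path_space\<close>)


section \<open>The first step of the process\<close>

lemma iterated_integral_mult:
  "iterated_integral M As (\<lambda>xs. c * g xs) = c * iterated_integral M As g"
  by (induction As arbitrary: g) simp_all

text \<open>This separates the transition from x to y from the chain that continues at y, whose
  indices then drop by one.\<close>

lemma prod_transition_Cons: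
  fixes h :: "'a \<Rightarrow> 'a \<Rightarrow> real \<Rightarrow> complex"
  shows "(\<Prod>i=1..Suc n. h ((x # y # xs) ! (i - 1)) ((x # y # xs) ! i) (\<tau> i - \<tau> (i - 1))) =
    h x y (\<tau> 1 - \<tau> 0) *
    (\<Prod>i=1..n. h ((y # xs) ! (i - 1)) ((y # xs) ! i) (\<tau> (Suc i) - \<tau> i))"
proof -
  have "(\<Prod>i=Suc 1..Suc n. h ((x # y # xs) ! (i - 1)) ((x # y # xs) ! i) (\<tau> i - \<tau> (i - 1))) =
      (\<Prod>i=1..n. h ((y # xs) ! (i - 1)) ((y # xs) ! i) (\<tau> (Suc i) - \<tau> i))"
    unfolding prod.shift_bounds_cl_Suc_ivl
  proof (intro prod.cong refl)
    fix i assume "i \<in> {1..n}"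
    then show "h ((x # y # xs) ! (Suc i - 1)) ((x # y # xs) ! Suc i) (\<tau> (Suc i) - \<tau> (Suc i - 1)) =
      h ((y # xs) ! (i - 1)) ((y # xs) ! i) (\<tau> (Suc i) - \<tau> i)"
      by (cases i) auto
  qed
  then show ?thesis
    by (subst prod.atLeast_Suc_atMost) auto
qed

text \<open>Pushing forward along the identity restricts \<mu> to the coordinate sigma-algebra, on
  which agreement and measurability can be tested on cylinders.\<close>

definition coordinate_law :: "(real \<Rightarrow> real ^ 'n::finite) measure \<Rightarrow> (real \<Rightarrow> real ^ 'n) measure" where
  "coordinate_law \<mu> = distr \<mu> (path_sigma {0..}) (\<lambda>\<omega>. \<omega>)"

lemma sets_coordinate_law [simp, measurable_cong]: "sets (coordinate_law \<mu>) = sets (path_sigma {0..})"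
  by (simp add: coordinate_law_def)

lemma space_coordinate_law [simp]: "space (coordinate_law \<mu>) = path_space"
  by (simp add: coordinate_law_def)

lemma measurable_coordinate_law [simp]:
  "measurable (coordinate_law \<mu>) N = measurable (path_sigma {0..}) N"
  by (rule measurable_cong_sets) simp_all

context
  fixes a :: real and P :: "real ^ 'n::finite \<Rightarrow> (real \<Rightarrow> real ^ 'n) measure"
  assumes fam: "deformed_Wiener_family a P"
begin

lemma prob_space_P: "prob_space (P x)"
  and space_P [simp]: "space (P x) = path_space"
  and sets_P [measurable_cong]: "sets (P x) = sets path_borel"
  and P_initial: "measure (P x) {\<omega> \<in> path_space. \<omega> 0 = x} = 1"
  using fam unfolding deformed_Wiener_family_def by auto

text \<open>The defining formula is extended to n = 0, where both sides are 1; an empty set of later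
  times needs this case.\<close>

lemma P_finite_dim:
  assumes "\<tau> 0 = 0" "\<And>i. i < n \<Longrightarrow> \<tau> i < \<tau> (Suc i)" "\<And>i. i \<in> {1..n} \<Longrightarrow> A i \<in> sets borel"
  shows "complex_of_real (measure (P x) {\<omega> \<in> path_space. \<forall>i\<in>{1..n}. \<omega> (\<tau> i) \<in> A i}) =
    iterated_integral (deformed_measure a) (map A [1..<Suc n])
      (\<lambda>xs. \<Prod>i=1..n. heat_kernel a ((x # xs) ! (i - 1)) ((x # xs) ! i) (\<tau> i - \<tau> (i - 1)))"
proof (cases "n = 0")
  case True
  then show ?thesis
    using prob_space.prob_space[OF prob_space_P[of x]] by simp
next
  case False
  have "\<forall>n \<ge> 1. \<forall>\<tau> A. \<tau> 0 = 0 \<and> (\<forall>i<n. \<tau> i < \<tau> (Suc i)) \<and> (\<forall>i\<in>{1..n}. A i \<in> sets borel) \<longrightarrow>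
      complex_of_real (measure (P x) {\<omega> \<in> path_space. \<forall>i\<in>{1..n}. \<omega> (\<tau> i) \<in> A i}) =
      iterated_integral (deformed_measure a) (map A [1..<Suc n])
        (\<lambda>xs. \<Prod>i=1..n. heat_kernel a ((x # xs) ! (i - 1)) ((x # xs) ! i) (\<tau> i - \<tau> (i - 1)))"
    using fam unfolding deformed_Wiener_family_def by (elim allE[of _ x] conjE)
  with False assms show ?thesis by simp
qed

text \<open>Both sides are finite-dimensional distributions; only the first factor of the kernel product
  has to be pulled out of the inner integrals, which for Bochner integrals needs no integrability.\<close>

lemma measure_P_first_step:
  fixes x :: "real ^ 'n"
  assumes d: "d > 0" and J: "finite J" "J \<subseteq> {0<..}" and A: "A \<in> sets borel"
    and C: "\<And>u. C u \<in> sets borel"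
  shows "complex_of_real (measure (P x) {\<omega> \<in> path_space. \<omega> d \<in> A \<and> (\<forall>u\<in>J. \<omega> (u + d) \<in> C u)}) =
    (LINT y:A|deformed_measure a. heat_kernel a x y d * of_real (measure (P y) (cylinder J C)))"
proof -
  \<comment> \<open>\<open>\<sigma>\<close> lists J increasingly with 0 in front, so it is the time
    grid of a path restarted at y. \<open>\<tau>\<close> is the same grid moved by d with a new
    initial time 0, hence \<open>\<tau> 1 = d\<close>; \<open>B\<close> puts A at that time and the
    sets of C at the later ones.\<close>
  define \<sigma> where "\<sigma> i = (0 # sorted_list_of_set J) ! i" for i
  define n where "n = card J"
  define \<tau> where "\<tau> i = (if i = 0 then 0 else \<sigma> (i - 1) + d)" for i
  define B where "B i = (if i = 1 then A else C (\<sigma> (i - 1)))" for i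
  have len: "length (sorted_list_of_set J) = n"
    by (simp add: n_def)
  have "sorted_wrt (<) (0 # sorted_list_of_set J)"
    using J by auto
  then have less: "\<sigma> i < \<sigma> (Suc i)" if "i < n" for i
    using that sorted_wrt_nth_less[of "(<)" "0 # sorted_list_of_set J" i "Suc i"]
    by (simp add: \<sigma>_def n_def)
  have \<sigma>0: "\<sigma> 0 = 0"
    by (simp add: \<sigma>_def)
  have range: "J = \<sigma> ` {1..n}"
  proof -
    have "J = set (sorted_list_of_set J)"
      using J by simp
    also have "\<dots> = (\<lambda>i. sorted_list_of_set J ! i) ` {..<n}"
      by (auto simp: set_conv_nth n_def)
    also have "\<dots> = (\<lambda>i. \<sigma> (Suc i)) ` {..<n}"
      by (simp add: \<sigma>_def)
    also have "\<dots> = \<sigma> ` {1..n}"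
      by (simp add: image_image[of \<sigma> Suc, symmetric] image_Suc_lessThan)
    finally show ?thesis .
  qed
  have C': "cylinder J C = {\<omega> \<in> path_space. \<forall>i\<in>{1..n}. \<omega> (\<sigma> i) \<in> C (\<sigma> i)}"
    unfolding cylinder_def range by auto
  have inner: "complex_of_real (measure (P y) (cylinder J C)) =
      iterated_integral (deformed_measure a) (map (\<lambda>i. C (\<sigma> i)) [1..<Suc n])
        (\<lambda>xs. \<Prod>i=1..n. heat_kernel a ((y # xs) ! (i - 1)) ((y # xs) ! i) (\<sigma> i - \<sigma> (i - 1)))" for y
    unfolding C' using \<sigma>0 less C by (intro P_finite_dim) auto
  have set_eq: "{\<omega> \<in> path_space. \<omega> d \<in> A \<and> (\<forall>u\<in>J. \<omega> (u + d) \<in> C u)} =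
      {\<omega> \<in> path_space. \<forall>i\<in>{1..Suc n}. \<omega> (\<tau> i) \<in> B i}"
  proof -
    have "{1..Suc n} = insert 1 (Suc ` {1..n})"
      by (auto simp: image_Suc_atLeastAtMost)
    then have "(\<forall>i\<in>{1..Suc n}. R i) \<longleftrightarrow> R 1 \<and> (\<forall>i\<in>{1..n}. R (Suc i))" for R
      by (auto simp del: image_Suc_atLeastAtMost)
    then show ?thesis
      unfolding range by (auto simp: \<tau>_def B_def \<sigma>0)
  qed
  have map_B: "map B [1..<Suc (Suc n)] = A # map (\<lambda>i. C (\<sigma> i)) [1..<Suc n]"
  proof -
    have "[1..<Suc (Suc n)] = 1 # map Suc [1..<Suc n]"
      by (subst upt_conv_Cons) (auto simp: map_Suc_upt)
    then show ?thesis by (auto simp: B_def simp del: upt_Suc)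
  qed
  have "complex_of_real (measure (P x) {\<omega> \<in> path_space. \<forall>i\<in>{1..Suc n}. \<omega> (\<tau> i) \<in> B i}) =
      iterated_integral (deformed_measure a) (map B [1..<Suc (Suc n)])
        (\<lambda>xs. \<Prod>i=1..Suc n. heat_kernel a ((x # xs) ! (i - 1)) ((x # xs) ! i) (\<tau> i - \<tau> (i - 1)))"
    using A C less d \<sigma>0 by (intro P_finite_dim) (auto simp: \<tau>_def B_def split: nat.split simp: less_Suc_eq_0_disj)
  also have "\<dots> = (LINT y:A|deformed_measure a. iterated_integral (deformed_measure a)
      (map (\<lambda>i. C (\<sigma> i)) [1..<Suc n])
      (\<lambda>xs. heat_kernel a x y d *
        (\<Prod>i=1..n. heat_kernel a ((y # xs) ! (i - 1)) ((y # xs) ! i) (\<tau> (Suc i) - \<tau> i))))"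
    unfolding map_B iterated_integral.simps prod_transition_Cons by (simp add: \<tau>_def \<sigma>0)
  also have "\<dots> = (LINT y:A|deformed_measure a. heat_kernel a x y d * of_real (measure (P y) (cylinder J C)))"
  proof -
    \<comment> \<open>Increments of \<open>\<tau>\<close> after its first step are those of
      \<open>\<sigma>\<close>, because d cancels.\<close>
    have prods: "(\<Prod>i=1..n. heat_kernel a ((y # xs) ! (i - 1)) ((y # xs) ! i) (\<tau> (Suc i) - \<tau> i)) =
        (\<Prod>i=1..n. heat_kernel a ((y # xs) ! (i - 1)) ((y # xs) ! i) (\<sigma> i - \<sigma> (i - 1)))" for y xs
      by (intro prod.cong) (auto simp: \<tau>_def)
    show ?thesis
      unfolding prods iterated_integral_mult inner ..
  qed
  finally show ?thesis
    unfolding set_eq .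
qed

section \<open>Cylinder probabilities as functions of the starting point\<close>

lemma cylinder_in_sets_P:
  "finite J \<Longrightarrow> J \<subseteq> {0..} \<Longrightarrow> (\<And>u. C u \<in> sets borel) \<Longrightarrow> cylinder J C \<in> sets (P x)"
  using measurable_sets[OF measurable_path_borel_path_sigma[of "{0..}"] cylinder_in_path_sigma[of J "{0..}" C]]
  by (simp add: sets_P Int_absorb2 cylinder_def)

lemma AE_P_initial: "AE \<omega> in P x. \<omega> 0 = x"
  using prob_space.AE_prob_1[OF prob_space_P P_initial] by eventually_elim simp

text \<open>The path starts at x almost surely, so a constraint at time 0 is a deterministic
  condition on x. This reduces matters to positive times, the ones covered by the finite-dimensional
  formula.\<close>

lemma measure_P_initial:
  assumes J: "finite J" "J \<subseteq> {0..}" and C: "\<And>u. C u \<in> sets borel"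
  shows "measure (P x) (cylinder J C) =
    indicator (if 0 \<in> J then C 0 else UNIV) x * measure (P x) (cylinder (J - {0}) C)"
proof -
  interpret prob_space "P x" by (rule prob_space_P)
  have "prob (cylinder J C) = prob (if x \<in> (if 0 \<in> J then C 0 else UNIV) then cylinder (J - {0}) C else {})"
  proof (rule finite_measure_eq_AE)
    show "AE \<omega> in P x. \<omega> \<in> cylinder J C \<longleftrightarrow>
        \<omega> \<in> (if x \<in> (if 0 \<in> J then C 0 else UNIV) then cylinder (J - {0}) C else {})"
      using AE_P_initial[of x] by eventually_elim (auto simp: cylinder_def)
  qed (use J C in \<open>auto intro!: cylinder_in_sets_P\<close>)
  then show ?thesis by (auto simp: indicator_def)
qed

text \<open>By induction on the number of times: the first-step formula at the smallest time writes
  the probability as a parameter integral of the heat kernel times a probability with one time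
  fewer.\<close>

lemma measurable_measure_P_cylinder_pos:
  assumes "finite J" "J \<subseteq> {0<..}" "\<And>u. C u \<in> sets borel"
  shows "(\<lambda>y. measure (P y) (cylinder J C)) \<in> borel_measurable borel"
  using assms
proof (induction "card J" arbitrary: J C)
  case 0
  then have "cylinder J C = path_space"
    by (simp add: cylinder_def)
  then show ?case
    using prob_space.prob_space[OF prob_space_P] by simp
next
  case (Suc k)
  then have ne: "J \<noteq> {}" by auto
  define d where "d = Min J"
  \<comment> \<open>Removing the minimum d before shifting by it keeps all remaining times strictly
    positive.\<close>
  define J' where "J' = (\<lambda>u. u - d) ` (J - {d})"
  define C' where "C' u = C (u + d)" for u
  have d: "d \<in> J" "d > 0"
    using Suc.prems ne Min_in[of J] by (auto simp: d_def)
  have J': "finite J'" "J' \<subseteq> {0<..}"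
    using Suc.prems Min_le[of J] d by (auto simp: J'_def d_def less_le)
  have "card J' = k"
    unfolding J'_def using Suc.hyps d Suc.prems by (subst card_image) (auto simp: inj_on_def)
  then have [measurable]: "(\<lambda>y. measure (P y) (cylinder J' C')) \<in> borel_measurable borel"
    using J' Suc by (auto simp: C'_def)
  have [measurable]: "C d \<in> sets borel"
    using Suc.prems by simp
  have "cylinder J C = {\<omega> \<in> path_space. \<omega> d \<in> C d \<and> (\<forall>u\<in>J'. \<omega> (u + d) \<in> C' u)}"
    using d by (auto simp: cylinder_def J'_def C'_def)
  then have *: "complex_of_real (measure (P x) (cylinder J C)) =
      (LINT y:C d|deformed_measure a. heat_kernel a x y d * of_real (measure (P y) (cylinder J' C')))" for x
    using measure_P_first_step[OF d(2) J', of "C d" C' x] Suc.prems by (simp add: C'_def)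
  note borel_measurable_heat_kernel[measurable]
  interpret sigma_finite_measure "deformed_measure a :: (real ^ 'n) measure"
    by (rule sigma_finite_deformed_measure)
  have "(\<lambda>x. complex_of_real (measure (P x) (cylinder J C))) \<in> borel_measurable borel"
    unfolding * set_lebesgue_integral_def
    by (rule borel_measurable_lebesgue_integral) measurable
  from measurable_compose[OF this borel_measurable_Re] show ?case by simp
qed

lemma measurable_measure_P_cylinder:
  assumes "finite J" "J \<subseteq> {0..}" "\<And>u. C u \<in> sets borel"
  shows "(\<lambda>y. measure (P y) (cylinder J C)) \<in> borel_measurable borel"
proof -
  have [measurable]: "(\<lambda>y. measure (P y) (cylinder (J - {0}) C)) \<in> borel_measurable borel"
    using assms by (intro measurable_measure_P_cylinder_pos) force+
  have [measurable]: "(if 0 \<in> J then C 0 else UNIV) \<in> sets borel"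
    using assms by simp
  show ?thesis
    unfolding measure_P_initial[OF assms] by measurable
qed

section \<open>The restricted laws as a probability kernel\<close>

abbreviation Q :: "real ^ 'n \<Rightarrow> (real \<Rightarrow> real ^ 'n) measure" where
  "Q x \<equiv> coordinate_law (P x)"

lemma measurable_id_P: "(\<lambda>\<omega>. \<omega>) \<in> P x \<rightarrow>\<^sub>M path_sigma {0..}"
  using measurable_path_borel_path_sigma[of "{0..}"] measurable_cong_sets[OF sets_P refl] by auto

lemma emeasure_Q:
  assumes "E \<in> sets (path_sigma {0..})"
  shows "emeasure (Q x) E = emeasure (P x) E"
proof -
  have "E \<subseteq> path_space"
    using sets.sets_into_space[OF assms] by simp
  then show ?thesis
    unfolding coordinate_law_def using assms
    by (subst emeasure_distr[OF measurable_id_P]) (auto simp: Int_absorb2)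
qed

lemma prob_space_Q: "prob_space (Q x)"
  unfolding coordinate_law_def by (intro prob_space.prob_space_distr prob_space_P measurable_id_P)

text \<open>Since cylinders form a generating pi-system, measurability of their probabilities makes
  \<open>Q\<close> a kernel, so that \<open>bind\<close> and its integral formulas apply.\<close>

lemma measurable_Q: "Q \<in> borel \<rightarrow>\<^sub>M prob_algebra (path_sigma {0..})"
proof (rule measurable_prob_algebra_generated[OF sets_path_sigma Int_stable_cylinders cylinders_subset])
  fix X :: "(real \<Rightarrow> real ^ 'n) set" assume "X \<in> cylinders {0..}"
  then obtain J C where X: "X = cylinder J C" "finite J" "J \<subseteq> {0..}" "\<And>u. C u \<in> sets borel"
    unfolding cylinders_def by blast
  have "emeasure (Q x) X = ennreal (measure (P x) X)" for x
    using X by (subst emeasure_Q)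
      (auto intro!: cylinder_in_path_sigma finite_measure.emeasure_eq_measure prob_space.finite_measure prob_space_P)
  then show "(\<lambda>x. emeasure (Q x) X) \<in> borel_measurable borel"
    using measurable_measure_P_cylinder[OF X(2-)] by (simp add: X)
qed (auto simp: prob_space_Q)

lemma AE_Q_initial: "AE \<omega> in Q x. \<omega> 0 = x"
  unfolding coordinate_law_def
  using AE_P_initial by (subst AE_distr_iff[OF measurable_id_P])
    (auto intro!: measurable_sets_Collect[OF measurable_path_eval, of 0 "{0..}" "\<lambda>y. y = x", simplified])

section \<open>The heat kernel as transition density\<close>

lemma integrable_heat_kernel:
  fixes x :: "real ^ 'n"
  assumes "d > 0"
  shows "integrable (deformed_measure a) (\<lambda>y. heat_kernel a x y d)"
proof (rule ccontr)
  assume "\<not> ?thesis"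
  moreover have "cylinder {} (\<lambda>_. UNIV) = (path_space :: (real \<Rightarrow> real ^ 'n) set)"
    by (simp add: cylinder_def)
  \<comment> \<open>A non-integrable function has Bochner integral 0, whereas the first-step formula
    over the whole space gives total mass 1.\<close>
  ultimately show False
    using measure_P_first_step[OF assms, of "{}" UNIV "\<lambda>_. UNIV" x]
      prob_space.prob_space[OF prob_space_P]
    by (simp add: not_integrable_integral_eq set_lebesgue_integral_def)
qed

text \<open>Probabilities are at most 1, so the integrand is dominated by the integrable heat
  kernel; taking real parts then gives a formula with genuine integrability.\<close>

lemma measure_P_first_step_Re:
  fixes x :: "real ^ 'n"
  assumes d: "d > 0" and J: "finite J" "J \<subseteq> {0<..}" and A: "A \<in> sets borel"
    and C: "\<And>u. C u \<in> sets borel"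
  shows "has_bochner_integral (deformed_measure a)
    (\<lambda>y. indicator A y * measure (P y) (cylinder J C) * Re (heat_kernel a x y d))
    (measure (P x) {\<omega> \<in> path_space. \<omega> d \<in> A \<and> (\<forall>u\<in>J. \<omega> (u + d) \<in> C u)})"
proof -
  note A[measurable] borel_measurable_heat_kernel[measurable]
    measurable_measure_P_cylinder_pos[OF J C, measurable]
  let ?f = "\<lambda>y. indicator A y *\<^sub>R (heat_kernel a x y d * of_real (measure (P y) (cylinder J C)))"
  have "integrable (deformed_measure a) ?f"
  proof (rule Bochner_Integration.integrable_bound[OF integrable_heat_kernel[OF d, of x]])
    show "AE y in deformed_measure a. norm (?f y) \<le> norm (heat_kernel a x y d)"
      using prob_space.prob_le_1[OF prob_space_P]
      by (auto simp: norm_mult indicator_def intro!: mult_left_le)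
  qed measurable
  then have "has_bochner_integral (deformed_measure a) (\<lambda>y. Re (?f y)) (Re (integral\<^sup>L (deformed_measure a) ?f))"
    by (intro has_bochner_integral_Re has_bochner_integral_integrable)
  also have "integral\<^sup>L (deformed_measure a) ?f =
      of_real (measure (P x) {\<omega> \<in> path_space. \<omega> d \<in> A \<and> (\<forall>u\<in>J. \<omega> (u + d) \<in> C u)})"
    using measure_P_first_step[OF assms] by (simp add: set_lebesgue_integral_def)
  finally show ?thesis
    by (simp add: ac_simps)
qed

text \<open>Over the set where the real part is negative its integral is a probability, hence
  nonnegative, although the integrand is nonpositive. The integral is therefore 0 and the integrand
  vanishes almost everywhere.\<close>

lemma AE_heat_kernel_nonneg:
  fixes x :: "real ^ 'n"
  assumes "d > 0"
  shows "AE y in deformed_measure a. 0 \<le> Re (heat_kernel a x y d)"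
proof -
  note borel_measurable_heat_kernel[measurable]
  define A where "A = {y. Re (heat_kernel a x y d) < 0}"
  have A: "A \<in> sets borel"
    unfolding A_def by measurable
  have P1: "measure (P y) (cylinder {} (\<lambda>_. UNIV)) = 1" for y
    using prob_space.prob_space[OF prob_space_P] by (simp add: cylinder_def)
  have "has_bochner_integral (deformed_measure a) (\<lambda>y. indicator A y * Re (heat_kernel a x y d))
      (measure (P x) {\<omega> \<in> path_space. \<omega> d \<in> A})"
    using measure_P_first_step_Re[OF assms, of "{}" A "\<lambda>_. UNIV" x] A by (simp add: P1)
  from has_bochner_integral_minus[OF this]
  have i: "has_bochner_integral (deformed_measure a) (\<lambda>y. - (indicator A y * Re (heat_kernel a x y d)))
      (- measure (P x) {\<omega> \<in> path_space. \<omega> d \<in> A})" .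
  have nn: "AE y in deformed_measure a. 0 \<le> - (indicator A y * Re (heat_kernel a x y d))"
    by (auto simp: A_def indicator_def)
  have "integral\<^sup>L (deformed_measure a) (\<lambda>y. - (indicator A y * Re (heat_kernel a x y d))) = 0"
    using has_bochner_integral_integral_eq[OF i] integral_nonneg_AE[OF nn] measure_nonneg by (smt (verit))
  then have "AE y in deformed_measure a. - (indicator A y * Re (heat_kernel a x y d)) = 0"
    using integral_nonneg_eq_0_iff_AE[OF _ nn] i by (auto simp: has_bochner_integral_iff)
  then show ?thesis
    by eventually_elim (auto simp: A_def indicator_def)
qed

text \<open>The first-step formula without later times gives the mass of each Borel set, and almost
  sure nonnegativity turns the Bochner integral into a nonnegative one.\<close>

lemma distr_P_eq_density:
  fixes x :: "real ^ 'n"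
  assumes "d > 0"
  shows "distr (Q x) borel (\<lambda>\<omega>. \<omega> d) = density (deformed_measure a) (\<lambda>y. ennreal (Re (heat_kernel a x y d)))"
proof (rule measure_eqI)
  fix A assume "A \<in> sets (distr (Q x) borel (\<lambda>\<omega>. \<omega> d))"
  then have A[measurable]: "A \<in> sets borel" by simp
  note borel_measurable_heat_kernel[measurable]
  have ev: "(\<lambda>\<omega>. \<omega> d) \<in> Q x \<rightarrow>\<^sub>M borel"
    using assms by (simp add: measurable_path_eval)
  have P1: "measure (P y) (cylinder {} (\<lambda>_. UNIV)) = 1" for y
    using prob_space.prob_space[OF prob_space_P] by (simp add: cylinder_def)
  have c: "{\<omega> \<in> path_space. \<omega> d \<in> A} = cylinder {d} (\<lambda>_. A)"
    by (auto simp: cylinder_def)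
  have i: "has_bochner_integral (deformed_measure a) (\<lambda>y. indicator A y * Re (heat_kernel a x y d))
      (measure (P x) {\<omega> \<in> path_space. \<omega> d \<in> A})"
    using measure_P_first_step_Re[OF assms, of "{}" A "\<lambda>_. UNIV" x] by (simp add: P1)
  have "emeasure (distr (Q x) borel (\<lambda>\<omega>. \<omega> d)) A = emeasure (Q x) {\<omega> \<in> path_space. \<omega> d \<in> A}"
    by (subst emeasure_distr[OF ev]) (auto simp: vimage_def Int_def conj_commute)
  also have "\<dots> = emeasure (P x) {\<omega> \<in> path_space. \<omega> d \<in> A}"
    unfolding c using assms by (intro emeasure_Q cylinder_in_path_sigma) auto
  also have "\<dots> = ennreal (measure (P x) {\<omega> \<in> path_space. \<omega> d \<in> A})"
    by (intro finite_measure.emeasure_eq_measure prob_space.finite_measure prob_space_P)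
  also have "\<dots> = (\<integral>\<^sup>+ y. ennreal (indicator A y * Re (heat_kernel a x y d)) \<partial>deformed_measure a)"
    using AE_heat_kernel_nonneg[OF assms, of x] i
    by (subst nn_integral_eq_integral) (auto simp: has_bochner_integral_iff indicator_def elim!: eventually_mono)
  also have "\<dots> = (\<integral>\<^sup>+ y. ennreal (Re (heat_kernel a x y d)) * indicator A y \<partial>deformed_measure a)"
    by (intro nn_integral_cong) (auto simp: indicator_def)
  also have "\<dots> = emeasure (density (deformed_measure a) (\<lambda>y. ennreal (Re (heat_kernel a x y d)))) A"
    by (subst emeasure_density) auto
  finally show "emeasure (distr (Q x) borel (\<lambda>\<omega>. \<omega> d)) A =
    emeasure (density (deformed_measure a) (\<lambda>y. ennreal (Re (heat_kernel a x y d)))) A" .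
qed simp


section \<open>The Markov property\<close>

lemma measurable_nn_integral_Q:
  assumes "g \<in> borel_measurable (path_sigma {0..})"
  shows "(\<lambda>y. \<integral>\<^sup>+ \<omega>. g \<omega> \<partial>Q y) \<in> borel_measurable borel"
  using measurable_compose[OF measurable_prob_algebraD[OF measurable_Q]
      nn_integral_measurable_subprob_algebra[OF assms]] .

lemma measurable_emeasure_Q:
  assumes "E \<in> sets (path_sigma {0..})"
  shows "(\<lambda>y. emeasure (Q y) E) \<in> borel_measurable borel"
  using measurable_compose[OF measurable_prob_algebraD[OF measurable_Q]
      measurable_emeasure_subprob_algebra[OF assms]] .

lemma emeasure_Q_cylinder:
  assumes "finite J" "J \<subseteq> {0..}" "\<And>u. C u \<in> sets borel"
  shows "emeasure (Q x) (cylinder J C) = ennreal (measure (P x) (cylinder J C))"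
  using assms by (subst emeasure_Q)
    (auto intro!: cylinder_in_path_sigma finite_measure.emeasure_eq_measure prob_space.finite_measure
      prob_space_P)

text \<open>The integral against the heat kernel is read as an integral against the law of the path
  at time d, which eliminates the kernel from everything that follows.\<close>

lemma Q_first_step_pos:
  fixes x :: "real ^ 'n"
  assumes d: "d > 0" and J: "finite J" "J \<subseteq> {0<..}" and A[measurable]: "A \<in> sets borel"
    and C: "\<And>u. C u \<in> sets borel"
  shows "emeasure (Q x) {\<omega> \<in> path_space. \<omega> d \<in> A \<and> time_shift d \<omega> \<in> cylinder J C} =
    (\<integral>\<^sup>+ \<omega>. indicator A (\<omega> d) * emeasure (Q (\<omega> d)) (cylinder J C) \<partial>Q x)"
proof -
  have J': "J \<subseteq> {0..}" using J by auto
  note borel_measurable_heat_kernel[measurable]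
    measurable_emeasure_Q[OF cylinder_in_path_sigma[OF J(1) J' C], measurable]
  let ?h = "\<lambda>y. Re (heat_kernel a x y d)" and ?D = "deformed_measure a :: (real ^ 'n) measure"
  have ev: "(\<lambda>\<omega>. \<omega> d) \<in> Q x \<rightarrow>\<^sub>M borel"
    using d by (simp add: measurable_path_eval)
  have 1: "has_bochner_integral ?D (\<lambda>y. indicator A y * measure (P y) (cylinder J C) * ?h y)
      (measure (P x) {\<omega> \<in> path_space. \<omega> d \<in> A \<and> (\<forall>u\<in>J. \<omega> (u + d) \<in> C u)})"
    by (rule measure_P_first_step_Re[OF assms])
  \<comment> \<open>The joint event is itself a cylinder: time d carries A, and each translated time
    carries its set from C.\<close>
  let ?K = "insert d ((\<lambda>u. u + d) ` J)"
    and ?C = "\<lambda>u. (if u = d then A else UNIV) \<inter> (if u - d \<in> J then C (u - d) else UNIV)"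
  have "0 \<notin> J" using J by auto
  then have c: "{\<omega> \<in> path_space. \<omega> d \<in> A \<and> (\<forall>u\<in>J. \<omega> (u + d) \<in> C u)} = cylinder ?K ?C"
    by (auto simp: cylinder_def)
  have "{\<omega> \<in> path_space. \<omega> d \<in> A \<and> time_shift d \<omega> \<in> cylinder J C} =
      {\<omega> \<in> path_space. \<omega> d \<in> A \<and> (\<forall>u\<in>J. \<omega> (u + d) \<in> C u)}"
    using time_shift_in_cylinder_iff[OF less_imp_le[OF d] J'] by auto
  then have "emeasure (Q x) {\<omega> \<in> path_space. \<omega> d \<in> A \<and> time_shift d \<omega> \<in> cylinder J C} =
      ennreal (measure (P x) {\<omega> \<in> path_space. \<omega> d \<in> A \<and> (\<forall>u\<in>J. \<omega> (u + d) \<in> C u)})"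
    unfolding c using J A C d by (simp only:, intro emeasure_Q_cylinder) (auto simp: subset_iff)
  also have "\<dots> = (\<integral>\<^sup>+ y. ennreal (indicator A y * measure (P y) (cylinder J C) * ?h y) \<partial>?D)"
    using AE_heat_kernel_nonneg[OF d, of x] 1
    by (subst nn_integral_eq_integral) (auto simp: has_bochner_integral_iff elim!: eventually_mono)
  also have "\<dots> = (\<integral>\<^sup>+ y. ennreal (?h y) * (indicator A y * emeasure (Q y) (cylinder J C)) \<partial>?D)"
    using AE_heat_kernel_nonneg[OF d, of x] emeasure_Q_cylinder[OF J(1) J' C]
    by (intro nn_integral_cong_AE)
       (auto simp: indicator_def ennreal_mult mult.commute elim!: eventually_mono)
  also have "\<dots> = (\<integral>\<^sup>+ y. indicator A y * emeasure (Q y) (cylinder J C) \<partial>distr (Q x) borel (\<lambda>\<omega>. \<omega> d))"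
    unfolding distr_P_eq_density[OF d] by (subst nn_integral_density) auto
  also have "\<dots> = (\<integral>\<^sup>+ \<omega>. indicator A (\<omega> d) * emeasure (Q (\<omega> d)) (cylinder J C) \<partial>Q x)"
    by (subst nn_integral_distr[OF ev]) auto
  finally show ?thesis .
qed

text \<open>For d = 0 the shift is trivial and the starting point is almost surely x. For d > 0 a
  constraint on the shifted path at time 0 is one on the path at time d, and is absorbed into
  A.\<close>

lemma Q_first_step:
  fixes x :: "real ^ 'n"
  assumes d: "d \<ge> 0" and J: "finite J" "J \<subseteq> {0..}" and A: "A \<in> sets borel"
    and C: "\<And>u. C u \<in> sets borel"
  shows "emeasure (Q x) {\<omega> \<in> path_space. \<omega> d \<in> A \<and> time_shift d \<omega> \<in> cylinder J C} =
    (\<integral>\<^sup>+ \<omega>. indicator A (\<omega> d) * emeasure (Q (\<omega> d)) (cylinder J C) \<partial>Q x)"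
proof (cases "d = 0")
  case True
  have E: "cylinder J C \<in> sets (path_sigma {0..})"
    using J C by (intro cylinder_in_path_sigma)
  have "{\<omega> \<in> path_space. \<omega> 0 \<in> A \<and> time_shift 0 \<omega> \<in> cylinder J C} =
      cylinder {0} (\<lambda>_. A) \<inter> cylinder J C"
    by (auto simp: time_shift_0 cylinder_def)
  then have "emeasure (Q x) {\<omega> \<in> path_space. \<omega> 0 \<in> A \<and> time_shift 0 \<omega> \<in> cylinder J C} =
      emeasure (Q x) (if x \<in> A then cylinder J C else {})"
  proof (simp only:, intro emeasure_eq_AE)
    show "AE \<omega> in Q x. \<omega> \<in> cylinder {0} (\<lambda>_. A) \<inter> cylinder J C \<longleftrightarrow>
        \<omega> \<in> (if x \<in> A then cylinder J C else {})"
      using AE_Q_initial[of x] by eventually_elim (auto simp: cylinder_def)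
    have "cylinder {0} (\<lambda>_. A) \<in> sets (path_sigma {0..})"
      using A by (intro cylinder_in_path_sigma) auto
    with E show "cylinder {0} (\<lambda>_. A) \<inter> cylinder J C \<in> sets (Q x)"
      by auto
  qed (use E in auto)
  also have "\<dots> = (\<integral>\<^sup>+ \<omega>. indicator A x * emeasure (Q x) (cylinder J C) \<partial>Q x)"
    using prob_space.emeasure_space_1[OF prob_space_Q[of x]] by (auto simp: indicator_def)
  also have "\<dots> = (\<integral>\<^sup>+ \<omega>. indicator A (\<omega> 0) * emeasure (Q (\<omega> 0)) (cylinder J C) \<partial>Q x)"
    using AE_Q_initial[of x] by (intro nn_integral_cong_AE) (auto elim!: eventually_mono)
  finally show ?thesis using True by simp
next
  case False
  let ?A = "A \<inter> (if 0 \<in> J then C 0 else UNIV)"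
  have "{\<omega> \<in> path_space. \<omega> d \<in> A \<and> time_shift d \<omega> \<in> cylinder J C} =
      {\<omega> \<in> path_space. \<omega> d \<in> ?A \<and> time_shift d \<omega> \<in> cylinder (J - {0}) C}"
    by (auto simp: cylinder_def)
  also have "emeasure (Q x) \<dots> =
      (\<integral>\<^sup>+ \<omega>. indicator ?A (\<omega> d) * emeasure (Q (\<omega> d)) (cylinder (J - {0}) C) \<partial>Q x)"
    using False assms by (intro Q_first_step_pos) force+
  also have "\<dots> = (\<integral>\<^sup>+ \<omega>. indicator A (\<omega> d) * emeasure (Q (\<omega> d)) (cylinder J C) \<partial>Q x)"
  proof (rule nn_integral_cong)
    fix \<omega>
    have "emeasure (Q (\<omega> d)) (cylinder J C) =
        ennreal (indicator (if 0 \<in> J then C 0 else UNIV) (\<omega> d) * measure (P (\<omega> d)) (cylinder (J - {0}) C))"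
      by (simp only: emeasure_Q_cylinder[OF J C] measure_P_initial[OF J C])
    moreover have "emeasure (Q (\<omega> d)) (cylinder (J - {0}) C) = ennreal (measure (P (\<omega> d)) (cylinder (J - {0}) C))"
      using J C by (intro emeasure_Q_cylinder) auto
    ultimately show "indicator ?A (\<omega> d) * emeasure (Q (\<omega> d)) (cylinder (J - {0}) C) =
        indicator A (\<omega> d) * emeasure (Q (\<omega> d)) (cylinder J C)"
      by (simp add: indicator_def)
  qed
  finally show ?thesis .
qed

text \<open>Both sides integrate g, against two finite measures: the law restricted to
  \<open>\<omega> d \<in> A\<close> and pushed forward by the shift, and the same restricted law
  followed by the kernel \<open>Q\<close>. They agree on cylinders by
  \<open>Q_first_step\<close>.\<close>

lemma simple_Markov:
  fixes x :: "real ^ 'n"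
  assumes d: "d \<ge> 0" and A[measurable]: "A \<in> sets borel"
    and g[measurable]: "g \<in> borel_measurable (path_sigma {0..})"
  shows "(\<integral>\<^sup>+ \<omega>. indicator A (\<omega> d) * g (time_shift d \<omega>) \<partial>Q x) =
    (\<integral>\<^sup>+ \<omega>. indicator A (\<omega> d) * (\<integral>\<^sup>+ \<omega>'. g \<omega>' \<partial>Q (\<omega> d)) \<partial>Q x)"
proof -
  have ev[measurable]: "(\<lambda>\<omega>. \<omega> d) \<in> path_sigma {0..} \<rightarrow>\<^sub>M borel"
    using d by (simp add: measurable_path_eval)
  have shift[measurable]: "time_shift d \<in> path_sigma {0..} \<rightarrow>\<^sub>M path_sigma {0..}"
    using d by (intro measurable_time_shift) auto
  note measurable_nn_integral_Q[measurable]
  define D where "D = density (Q x) (\<lambda>\<omega>. indicator A (\<omega> d))"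
  have meas_D: "measurable D N = measurable (path_sigma {0..}) N" for N :: "'c measure"
    by (rule measurable_cong_sets) (simp_all add: D_def)
  have shift_D: "time_shift d \<in> D \<rightarrow>\<^sub>M path_sigma {0..}"
    unfolding meas_D by measurable
  have ker: "(\<lambda>\<omega>. Q (\<omega> d)) \<in> D \<rightarrow>\<^sub>M subprob_algebra (path_sigma {0..})"
    unfolding meas_D
    by (rule measurable_compose[OF ev measurable_prob_algebraD[OF measurable_Q]])
  have ne: "space D \<noteq> {}"
    using prob_space.not_empty[OF prob_space_Q[of x]] by (simp add: D_def)
  have "distr D (path_sigma {0..}) (time_shift d) = D \<bind> (\<lambda>\<omega>. Q (\<omega> d))"
  proof (rule measure_eqI_generator_eq[OF Int_stable_cylinders cylinders_subset])
    show "sets (D \<bind> (\<lambda>\<omega>. Q (\<omega> d))) = sigma_sets path_space (cylinders {0..})"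
      using ne by (subst sets_bind[where N="path_sigma {0..}"]) (auto simp: sets_path_sigma)
    show "range (\<lambda>_. path_space) \<subseteq> cylinders {0..}"
      using path_space_in_cylinders by auto
    \<comment> \<open>Uniqueness from a pi-system needs finite mass; restriction to an event leaves
      at most 1.\<close>
    have "emeasure D (space D) = (\<integral>\<^sup>+ \<omega>. indicator A (\<omega> d) * indicator (space D) \<omega> \<partial>Q x)"
      unfolding D_def by (rule emeasure_density) (simp_all, measurable)
    also have "\<dots> \<le> (\<integral>\<^sup>+ \<omega>. 1 \<partial>Q x)"
      by (intro nn_integral_mono) (auto simp: indicator_def)
    finally have "emeasure D (space D) \<le> 1"
      using prob_space.emeasure_space_1[OF prob_space_Q[of x]] by simp
    moreover have "time_shift d -` path_space \<inter> space D = space D"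
      using d by (auto simp: D_def time_shift_in_path_space)
    ultimately show "emeasure (distr D (path_sigma {0..}) (time_shift d)) path_space \<noteq> \<infinity>" for i :: nat
      by (subst emeasure_distr[OF shift_D]) (auto simp: top_unique)
    fix X :: "(real \<Rightarrow> real ^ 'n) set" assume "X \<in> cylinders {0..}"
    then obtain J C where X: "X = cylinder J C" "finite J" "J \<subseteq> {0..}" "\<And>u. C u \<in> sets borel"
      unfolding cylinders_def by blast
    have E[measurable]: "X \<in> sets (path_sigma {0..})"
      using X by (auto intro: cylinder_in_path_sigma)
    let ?Y = "time_shift d -` X \<inter> path_space" and ?Z = "(\<lambda>\<omega>. \<omega> d) -` A \<inter> path_space"
    have [measurable]: "?Y \<in> sets (path_sigma {0..})" "?Z \<in> sets (path_sigma {0..})"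
      using measurable_sets[OF shift E] measurable_sets[OF ev A] by auto
    have "emeasure (distr D (path_sigma {0..}) (time_shift d)) X = emeasure D ?Y"
      by (subst emeasure_distr[OF shift_D E]) (simp add: D_def)
    also have "\<dots> = (\<integral>\<^sup>+ \<omega>. indicator A (\<omega> d) * indicator ?Y \<omega> \<partial>Q x)"
      unfolding D_def by (rule emeasure_density) (simp_all, measurable)
    also have "\<dots> = (\<integral>\<^sup>+ \<omega>. indicator (?Z \<inter> ?Y) \<omega> \<partial>Q x)"
      by (intro nn_integral_cong) (auto simp: indicator_def)
    also have "\<dots> = emeasure (Q x) (?Z \<inter> ?Y)"
      by (intro nn_integral_indicator) auto
    also have "\<dots> = emeasure (Q x) {\<omega> \<in> path_space. \<omega> d \<in> A \<and> time_shift d \<omega> \<in> cylinder J C}"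
      unfolding X by (rule arg_cong[of _ _ "emeasure (Q x)"]) auto
    also have "\<dots> = (\<integral>\<^sup>+ \<omega>. indicator A (\<omega> d) * emeasure (Q (\<omega> d)) X \<partial>Q x)"
      unfolding X by (rule Q_first_step[OF d X(2,3) A X(4)])
    also have "\<dots> = (\<integral>\<^sup>+ \<omega>. emeasure (Q (\<omega> d)) X \<partial>D)"
      unfolding D_def using measurable_compose[OF ev measurable_emeasure_Q[OF E]]
      by (subst nn_integral_density) auto
    also have "\<dots> = emeasure (D \<bind> (\<lambda>\<omega>. Q (\<omega> d))) X"
      by (subst emeasure_bind[OF ne ker E]) simp
    finally show "emeasure (distr D (path_sigma {0..}) (time_shift d)) X = emeasure (D \<bind> (\<lambda>\<omega>. Q (\<omega> d))) X" .
  qed (auto simp: sets_path_sigma)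
  then have "(\<integral>\<^sup>+ \<omega>. g \<omega> \<partial>distr D (path_sigma {0..}) (time_shift d)) = (\<integral>\<^sup>+ \<omega>. g \<omega> \<partial>(D \<bind> (\<lambda>\<omega>. Q (\<omega> d))))"
    by simp
  then have "(\<integral>\<^sup>+ \<omega>. g (time_shift d \<omega>) \<partial>D) = (\<integral>\<^sup>+ \<omega>. \<integral>\<^sup>+ \<omega>'. g \<omega>' \<partial>Q (\<omega> d) \<partial>D)"
    by (simp add: nn_integral_distr[OF shift_D] nn_integral_bind[OF g ker])
  then show ?thesis
    unfolding D_def by (simp add: nn_integral_density)
qed

text \<open>By induction on the number of past times: \<open>simple_Markov\<close> at the smallest
  time d restarts the path there, the induction hypothesis with horizon \<open>t - d\<close> treats
  the remaining times, and \<open>simple_Markov\<close> read backwards undoes the restart.\<close>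

lemma Markov_cylinder:
  fixes x :: "real ^ 'n"
  assumes "finite J" "J \<subseteq> {0..t}" "t \<ge> 0" and C: "\<And>u. C u \<in> sets borel"
    and g[measurable]: "g \<in> borel_measurable (path_sigma {0..})"
  shows "(\<integral>\<^sup>+ \<omega>. indicator (cylinder J C) \<omega> * g (time_shift t \<omega>) \<partial>Q x) =
    (\<integral>\<^sup>+ \<omega>. indicator (cylinder J C) \<omega> * (\<integral>\<^sup>+ \<omega>'. g \<omega>' \<partial>Q (\<omega> t)) \<partial>Q x)"
  using assms(1-4)
proof (induction "card J" arbitrary: J t C x)
  case 0
  then have "cylinder J C = path_space"
    by (simp add: cylinder_def)
  \<comment> \<open>Without past constraints the claim is \<open>simple_Markov\<close> with A =
    \<open>UNIV\<close>.\<close>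
  then have "indicator (cylinder J C) \<omega> = (indicator UNIV (\<omega> t) :: ennreal)" if "\<omega> \<in> space (Q x)" for \<omega>
    using that by simp
  then show ?case
    using simple_Markov[OF \<open>t \<ge> 0\<close>, of UNIV g x] by (simp cong: nn_integral_cong_simp)
next
  case (Suc k)
  then have ne: "J \<noteq> {}" by auto
  define d where "d = Min J"
  define J' where "J' = (\<lambda>u. u - d) ` (J - {d})"
  define C' where "C' u = C (u + d)" for u
  have "d \<in> J"
    using Suc.prems ne by (simp add: d_def)
  then have d: "d \<in> J" "d \<ge> 0" "d \<le> t"
    using Suc.prems by auto
  have J': "finite J'" "J' \<subseteq> {0..t - d}"
    using Suc.prems Min_le[of J] by (auto simp: J'_def d_def)
  have card: "card J' = k"
    unfolding J'_def using Suc.hyps d Suc.prems by (subst card_image) (auto simp: inj_on_def)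
  have C': "C' u \<in> sets borel" for u
    using Suc.prems by (simp add: C'_def)
  have split: "indicator (cylinder J C) \<omega> = (indicator (C d) (\<omega> d) * indicator (cylinder J' C') (time_shift d \<omega>) :: ennreal)"
    if "\<omega> \<in> path_space" for \<omega>
  proof -
    have "J' \<subseteq> {0..}" using J' by auto
    then have "time_shift d \<omega> \<in> cylinder J' C' \<longleftrightarrow> (\<forall>u\<in>J - {d}. \<omega> u \<in> C u)"
      using time_shift_in_cylinder_iff[of d J' \<omega> C'] d that by (simp add: J'_def C'_def)
    then show ?thesis
      using that d by (auto simp: cylinder_def indicator_def)
  qed
  have [measurable]: "cylinder J' C' \<in> sets (path_sigma {0..})"
    using J' C' by (intro cylinder_in_path_sigma) auto
  have [measurable]: "time_shift (t - d) \<in> path_sigma {0..} \<rightarrow>\<^sub>M path_sigma {0..}"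
    using d by (intro measurable_time_shift) auto
  have ev[measurable]: "(\<lambda>\<omega>. \<omega> (t - d)) \<in> path_sigma {0..} \<rightarrow>\<^sub>M borel"
    using d by (intro measurable_path_eval) auto
  have [measurable]: "(\<lambda>\<omega>. \<integral>\<^sup>+ \<omega>'. g \<omega>' \<partial>Q (\<omega> (t - d))) \<in> borel_measurable (path_sigma {0..})"
    by (rule measurable_compose[OF ev measurable_nn_integral_Q[OF g]])
  \<comment> \<open>These are the two integrands of the induction hypothesis, viewed as functionals
    of the path already shifted by d.\<close>
  let ?g1 = "\<lambda>\<omega>. indicator (cylinder J' C') \<omega> * g (time_shift (t - d) \<omega>)"
  let ?g2 = "\<lambda>\<omega>. indicator (cylinder J' C') \<omega> * (\<integral>\<^sup>+ \<omega>'. g \<omega>' \<partial>Q (\<omega> (t - d)))"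
  have Cd: "C d \<in> sets borel"
    using Suc.prems by simp
  have "(\<integral>\<^sup>+ \<omega>. indicator (cylinder J C) \<omega> * g (time_shift t \<omega>) \<partial>Q x) =
      (\<integral>\<^sup>+ \<omega>. indicator (C d) (\<omega> d) * ?g1 (time_shift d \<omega>) \<partial>Q x)"
    using d by (intro nn_integral_cong) (simp add: split time_shift_time_shift mult.assoc)
  also have "\<dots> = (\<integral>\<^sup>+ \<omega>. indicator (C d) (\<omega> d) * (\<integral>\<^sup>+ \<omega>'. ?g1 \<omega>' \<partial>Q (\<omega> d)) \<partial>Q x)"
    by (rule simple_Markov[OF d(2) Cd]) measurable
  also have "\<dots> = (\<integral>\<^sup>+ \<omega>. indicator (C d) (\<omega> d) * (\<integral>\<^sup>+ \<omega>'. ?g2 \<omega>' \<partial>Q (\<omega> d)) \<partial>Q x)"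
    using Suc.hyps(1)[OF card[symmetric] J' _ C'] d by simp
  also have "\<dots> = (\<integral>\<^sup>+ \<omega>. indicator (C d) (\<omega> d) * ?g2 (time_shift d \<omega>) \<partial>Q x)"
    by (rule simple_Markov[OF d(2) Cd, symmetric]) measurable
  also have "\<dots> = (\<integral>\<^sup>+ \<omega>. indicator (cylinder J C) \<omega> * (\<integral>\<^sup>+ \<omega>'. g \<omega>' \<partial>Q (\<omega> t)) \<partial>Q x)"
    using d by (intro nn_integral_cong) (simp add: split mult.assoc)
  finally show ?case .
qed

text \<open>Both sides are finite measures as functions of the past event A, and they agree on the
  pi-system of past cylinders.\<close>

lemma Markov_nn_integral:
  fixes x :: "real ^ 'n"
  assumes t: "t \<ge> 0" and A: "A \<in> sets (path_sigma {0..t})"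
    and g[measurable]: "g \<in> borel_measurable (path_sigma {0..})"
    and bound: "\<And>\<omega>. \<omega> \<in> path_space \<Longrightarrow> g \<omega> \<le> ennreal c"
  shows "(\<integral>\<^sup>+ \<omega>. indicator A \<omega> * g (time_shift t \<omega>) \<partial>Q x) =
    (\<integral>\<^sup>+ \<omega>. indicator A \<omega> * (\<integral>\<^sup>+ \<omega>'. g \<omega>' \<partial>Q (\<omega> t)) \<partial>Q x)"
proof -
  define F1 where "F1 \<omega> = g (time_shift t \<omega>)" for \<omega>
  define F2 where "F2 \<omega> = (\<integral>\<^sup>+ \<omega>'. g \<omega>' \<partial>Q (\<omega> t))" for \<omega>
  have shift: "time_shift t \<in> path_sigma {0..} \<rightarrow>\<^sub>M path_sigma {0..}"
    using t by (intro measurable_time_shift) auto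
  have ev: "(\<lambda>\<omega>. \<omega> t) \<in> path_sigma {0..} \<rightarrow>\<^sub>M borel"
    using t by (intro measurable_path_eval) auto
  have F1: "F1 \<in> borel_measurable (path_sigma {0..})"
    unfolding F1_def[abs_def] by (rule measurable_compose[OF shift g])
  have F2: "F2 \<in> borel_measurable (path_sigma {0..})"
    unfolding F2_def[abs_def] by (rule measurable_compose[OF ev measurable_nn_integral_Q[OF g]])
  \<comment> \<open>\<open>\<nu> F\<close> is the measure with density \<open>F\<close>, restricted
    to the past up to t; the two sides are its values at A for \<open>F1\<close> and
    \<open>F2\<close>.\<close>
  define \<nu> where "\<nu> F = distr (density (Q x) F) (path_sigma {0..t}) (\<lambda>\<omega>. \<omega>)" for F
  have \<nu>: "emeasure (\<nu> F) X = (\<integral>\<^sup>+ \<omega>. indicator X \<omega> * F \<omega> \<partial>Q x)"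
    if F: "F \<in> borel_measurable (path_sigma {0..})" and X: "X \<in> sets (path_sigma {0..t})" for F X
  proof -
    have m: "(\<lambda>\<omega>. \<omega>) \<in> path_sigma {0..} \<rightarrow>\<^sub>M path_sigma {0..t}"
      by (intro measurable_path_sigma_mono) auto
    have "X \<subseteq> path_space"
      using sets.sets_into_space[OF X] by simp
    then have X': "X \<in> sets (path_sigma {0..})"
      using measurable_sets[OF m X] by (simp add: Int_absorb2)
    have m': "(\<lambda>\<omega>. \<omega>) \<in> density (Q x) F \<rightarrow>\<^sub>M path_sigma {0..t}"
      using m by simp
    have "emeasure (\<nu> F) X = emeasure (density (Q x) F) X"
      unfolding \<nu>_def emeasure_distr[OF m' X] using \<open>X \<subseteq> path_space\<close> by (simp add: Int_absorb2)
    also have "\<dots> = (\<integral>\<^sup>+ \<omega>. F \<omega> * indicator X \<omega> \<partial>Q x)"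
      using F X' by (intro emeasure_density) auto
    finally show ?thesis by (simp add: mult.commute)
  qed
  have "\<nu> F1 = \<nu> F2"
  proof (rule measure_eqI_generator_eq[OF Int_stable_cylinders cylinders_subset])
    fix X :: "(real \<Rightarrow> real ^ 'n) set" assume X: "X \<in> cylinders {0..t}"
    then have X': "X \<in> sets (path_sigma {0..t})"
      by (simp add: sets_path_sigma)
    from X obtain J C where J: "X = cylinder J C" "finite J" "J \<subseteq> {0..t}" "\<And>u. C u \<in> sets borel"
      unfolding cylinders_def by blast
    show "emeasure (\<nu> F1) X = emeasure (\<nu> F2) X"
      unfolding \<nu>[OF F1 X'] \<nu>[OF F2 X'] unfolding F1_def F2_def J(1)
      by (rule Markov_cylinder[OF J(2,3) t J(4) g])
  next
    show "range (\<lambda>_. path_space) \<subseteq> cylinders {0..t}"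
      using path_space_in_cylinders by auto
    \<comment> \<open>The bound on g enters here, to keep the total mass finite.\<close>
    from \<nu>[OF F1 path_space_in_path_sigma] have "emeasure (\<nu> F1) path_space = (\<integral>\<^sup>+ \<omega>. indicator path_space \<omega> * F1 \<omega> \<partial>Q x)" .
    also have "\<dots> \<le> (\<integral>\<^sup>+ \<omega>. ennreal c \<partial>Q x)"
      using bound t by (intro nn_integral_mono) (simp add: F1_def time_shift_in_path_space)
    also have "\<dots> = ennreal c"
      using prob_space.emeasure_space_1[OF prob_space_Q[of x]] by simp
    finally show "emeasure (\<nu> F1) path_space \<noteq> \<infinity>" for i :: nat
      by (auto simp: top_unique)
  qed (auto simp: \<nu>_def sets_path_sigma)
  then show ?thesis
    using \<nu>[OF F1 A] \<nu>[OF F2 A] by (simp add: F1_def F2_def)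
qed

end

section \<open>From nonnegative functionals to the conditional expectation\<close>

theorem proposition5p13:
  fixes a s t :: real
    and P :: "real ^ 'n::finite \<Rightarrow> (real \<Rightarrow> real ^ 'n) measure"
    and f :: "(real \<Rightarrow> real ^ 'n) \<Rightarrow> real"
    and x :: "real ^ 'n"
  assumes "a > max 0 (2 - real CARD('n))"
    and "deformed_Wiener_family a P"
    and "s \<ge> 0" and "t \<ge> 0"
    and "f \<in> borel_measurable (path_filtration s)"
    and "bounded (f ` path_space)"
  shows "AE \<omega> in P x.
           real_cond_exp (P x) (path_filtration t) (\<lambda>\<omega>. f (time_shift t \<omega>)) \<omega> =
           (\<integral>\<omega>'. f \<omega>' \<partial>P (\<omega> t))"
proof -
  note fam = assms(2)
  let ?G = "path_sigma {0..} :: (real \<Rightarrow> real ^ 'n) measure"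
  let ?F = "path_sigma {0..t} :: (real \<Rightarrow> real ^ 'n) measure"
  let ?Q = "\<lambda>y. coordinate_law (P y)"
  obtain c where c: "\<And>\<omega>. \<omega> \<in> path_space \<Longrightarrow> \<bar>f \<omega>\<bar> \<le> c"
    using assms(6) by (auto simp: bounded_iff)
  have "f \<in> borel_measurable (path_sigma {0..s})"
    using assms(5) measurable_cong_sets[OF sets_path_filtration refl] by blast
  from measurable_compose[OF measurable_path_sigma_mono this, of "{0..}"]
  have f[measurable]: "f \<in> borel_measurable ?G" by auto
  \<comment> \<open>\<open>U\<close> is formed with the restricted law, for which kernel
    measurability is available; \<open>U_P\<close> identifies it with the expectation under
    \<open>P y\<close>.\<close>
  define U where "U y = (\<integral>\<omega>. f \<omega> \<partial>?Q y)" for y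
  have U_P: "(\<integral>\<omega>. f \<omega> \<partial>P y) = U y" for y
    unfolding U_def coordinate_law_def by (rule integral_distr[OF measurable_id_P[OF fam] f, symmetric])
  have U[measurable]: "U \<in> borel_measurable borel"
    unfolding U_def
    by (rule measurable_compose[OF measurable_prob_algebraD[OF measurable_Q[OF fam]]
        integral_measurable_subprob_algebra[OF f]])
  have shift[measurable]: "time_shift t \<in> ?G \<rightarrow>\<^sub>M ?G"
    using \<open>t \<ge> 0\<close> by (intro measurable_time_shift) auto
  have ev[measurable]: "(\<lambda>\<omega>. \<omega> t) \<in> ?G \<rightarrow>\<^sub>M borel"
    using \<open>t \<ge> 0\<close> by (intro measurable_path_eval) auto
  have F_G: "sets ?F \<subseteq> sets ?G"
    using measurable_sets[OF measurable_path_sigma_mono[of "{0..t}" "{0..}"]] sets.sets_into_space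
    by (fastforce simp: Int_absorb2)
  have G_P: "sets ?G \<subseteq> sets (P x)"
    using measurable_sets[OF measurable_id_P[OF fam]] sets.sets_into_space
    by (fastforce simp: Int_absorb2 space_P[OF fam])
  have int_Q: "integrable (?Q y) u" if [measurable]: "u \<in> borel_measurable ?G" and "\<And>\<omega>. \<omega> \<in> path_space \<Longrightarrow> \<bar>u \<omega>\<bar> \<le> b"
    for y b and u :: "(real \<Rightarrow> real ^ 'n) \<Rightarrow> real"
    using that by (intro finite_measure.integrable_const_bound[where B=b] prob_space.finite_measure
        prob_space_Q[OF fam]) auto
  have U_bound: "\<bar>U y\<bar> \<le> c" for y
  proof -
    interpret prob_space "?Q y" by (rule prob_space_Q[OF fam])
    have "norm (U y) \<le> (\<integral>\<omega>. norm (f \<omega>) \<partial>?Q y)"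
      unfolding U_def by (rule integral_norm_bound)
    also have "\<dots> \<le> (\<integral>\<omega>. c \<partial>?Q y)"
      using c by (intro integral_mono integrable_const int_Q[where b=c]) auto
    finally show ?thesis
      using prob_space by simp
  qed
  have eq_Q: "(\<integral>\<omega>. indicator A \<omega> * f (time_shift t \<omega>) \<partial>?Q x) = (\<integral>\<omega>. indicator A \<omega> * U (\<omega> t) \<partial>?Q x)"
    if A: "A \<in> sets ?F" for A
  proof -
    have [measurable]: "A \<in> sets ?G" using A F_G by auto
    have nn: "(\<integral>\<^sup>+ \<omega>. ennreal (f \<omega> + c) \<partial>?Q y) = ennreal (U y + c)" for y
    proof -
      interpret prob_space "?Q y" by (rule prob_space_Q[OF fam])
      have i: "integrable (?Q y) f" using c by (intro int_Q[where b=c]) auto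
      have "(\<integral>\<^sup>+ \<omega>. ennreal (f \<omega> + c) \<partial>?Q y) = ennreal (\<integral>\<omega>. f \<omega> + c \<partial>?Q y)"
        using i by (intro nn_integral_eq_integral) (auto intro!: AE_I2 simp: dest!: c)
      then show ?thesis
        using i prob_space by (simp add: U_def)
    qed
    \<comment> \<open>Adding the bound c makes u nonnegative. The subtracted term is the same for
      the shifted f and for \<open>U\<close>, so it suffices to compare the nonnegative
      integrals.\<close>
    have *: "(\<integral>\<omega>. indicator A \<omega> * u \<omega> \<partial>?Q x) =
        enn2real (\<integral>\<^sup>+ \<omega>. indicator A \<omega> * ennreal (u \<omega> + c) \<partial>?Q x) - (\<integral>\<omega>. indicator A \<omega> * c \<partial>?Q x)"
      if [measurable]: "u \<in> borel_measurable ?G" and b: "\<And>\<omega>. \<omega> \<in> path_space \<Longrightarrow> \<bar>u \<omega>\<bar> \<le> c"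
      for u :: "(real \<Rightarrow> real ^ 'n) \<Rightarrow> real"
    proof -
      have iu: "integrable (?Q x) (\<lambda>\<omega>. indicator A \<omega> * u \<omega>)"
      proof (rule int_Q)
        show "\<bar>indicator A \<omega> * u \<omega>\<bar> \<le> \<bar>c\<bar>" if "\<omega> \<in> path_space" for \<omega>
          using b[OF that] by (auto simp: indicator_def)
      qed measurable
      have ic: "integrable (?Q x) (\<lambda>\<omega>. indicator A \<omega> * c)"
        by (rule int_Q[where b = "\<bar>c\<bar>"]) (auto simp: indicator_def)
      have "(\<integral>\<omega>. indicator A \<omega> * u \<omega> \<partial>?Q x) =
          (\<integral>\<omega>. indicator A \<omega> * (u \<omega> + c) \<partial>?Q x) - (\<integral>\<omega>. indicator A \<omega> * c \<partial>?Q x)"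
        by (simp add: distrib_left Bochner_Integration.integral_add[OF iu ic])
      also have "(\<integral>\<omega>. indicator A \<omega> * (u \<omega> + c) \<partial>?Q x) =
          enn2real (\<integral>\<^sup>+ \<omega>. ennreal (indicator A \<omega> * (u \<omega> + c)) \<partial>?Q x)"
      proof (rule integral_eq_nn_integral)
        show "AE \<omega> in ?Q x. 0 \<le> indicator A \<omega> * (u \<omega> + c)"
          using b by (intro AE_I2) (fastforce simp: indicator_def)
      qed simp
      also have "(\<integral>\<^sup>+ \<omega>. ennreal (indicator A \<omega> * (u \<omega> + c)) \<partial>?Q x) =
          (\<integral>\<^sup>+ \<omega>. indicator A \<omega> * ennreal (u \<omega> + c) \<partial>?Q x)"
        by (intro nn_integral_cong) (simp add: indicator_def)
      finally show ?thesis .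
    qed
    \<comment> \<open>The functional f + c is nonnegative and at most 2c, so the Markov property for
      bounded nonnegative functionals applies.\<close>
    have "(\<integral>\<^sup>+ \<omega>. indicator A \<omega> * ennreal (f (time_shift t \<omega>) + c) \<partial>?Q x) =
        (\<integral>\<^sup>+ \<omega>. indicator A \<omega> * (\<integral>\<^sup>+ \<omega>'. ennreal (f \<omega>' + c) \<partial>?Q (\<omega> t)) \<partial>?Q x)"
      by (rule Markov_nn_integral[OF fam \<open>t \<ge> 0\<close> A, where c = "2 * c"]) (auto intro!: ennreal_leI dest!: c)
    then show ?thesis
      using c U_bound \<open>t \<ge> 0\<close> by (simp add: * nn time_shift_in_path_space)
  qed
  interpret P: prob_space "P x" by (rule prob_space_P[OF fam])
  have sets_F: "sets (path_filtration t) = sets ?F"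
    by (rule sets_path_filtration)
  then have "subalgebra (P x) (path_filtration t)"
    using F_G G_P sets_eq_imp_space_eq[OF sets_F] by (auto simp: subalgebra_def space_P[OF fam])
  then interpret finite_measure_subalgebra "P x" "path_filtration t"
    by unfold_locales
  have int_P: "integrable (P x) u \<longleftrightarrow> integrable (?Q x) u" and LINT_P: "(\<integral>\<omega>. u \<omega> \<partial>P x) = (\<integral>\<omega>. u \<omega> \<partial>?Q x)"
    if "u \<in> borel_measurable ?G" for u :: "(real \<Rightarrow> real ^ 'n) \<Rightarrow> real"
    unfolding coordinate_law_def
    using that integral_distr[OF measurable_id_P[OF fam] that] integrable_distr_eq[OF measurable_id_P[OF fam] that]
    by auto
  show ?thesis
    unfolding U_P
  proof (rule real_cond_exp_charact)
    fix A :: "(real \<Rightarrow> real ^ 'n) set" assume "A \<in> sets (path_filtration t)"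
    then have A: "A \<in> sets ?F" using sets_F by simp
    then have [measurable]: "A \<in> sets ?G" using F_G by auto
    show "(LINT \<omega>:A|P x. f (time_shift t \<omega>)) = (LINT \<omega>:A|P x. U (\<omega> t))"
      using eq_Q[OF A] by (simp add: set_lebesgue_integral_def LINT_P)
  next
    show "integrable (P x) (\<lambda>\<omega>. f (time_shift t \<omega>))"
      using c \<open>t \<ge> 0\<close> by (subst int_P) (auto intro!: int_Q[where b=c] simp: time_shift_in_path_space)
    show "integrable (P x) (\<lambda>\<omega>. U (\<omega> t))"
      using U_bound by (subst int_P) (auto intro!: int_Q[where b=c])
    \<comment> \<open>The candidate depends only on the path at time t, which belongs to the closed
      interval \<open>{0..t}\<close>; this gives measurability with respect to the past.\<close>
    have "(\<lambda>\<omega>. \<omega> t) \<in> ?F \<rightarrow>\<^sub>M borel"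
      using \<open>t \<ge> 0\<close> by (intro measurable_path_eval) auto
    then have "(\<lambda>\<omega>. U (\<omega> t)) \<in> borel_measurable ?F"
      by (rule measurable_compose[OF _ U])
    then show "(\<lambda>\<omega>. U (\<omega> t)) \<in> borel_measurable (path_filtration t)"
      using measurable_cong_sets[OF sets_F refl] by blast
  qed
qed

end
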